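(* Let $\rho_0,\rho_1$ be arbitrary density operators on $\mathbb C^d$. Then, for $0<a<1$, $$\mathcal A_{\rho_0,\rho_1}(a)=\max_{0\preceq R\preceq\mathbf 1}\Phi(a,R),\qquad \Phi(a,R)=a\,\mathrm{Tr}\,\rho_0\log\frac Ra+(1-a)\,\mathrm{Tr}\,\rho_1\log\frac{\mathbf 1-R}{1-a},$$ with boundary values of $\Phi$ given by the upper-semicontinuous support convention. The map $(a,R)\mapsto\Phi(a,R)$ is jointly concave, and $a\mapsto\mathcal A_{\rho_0,\rho_1}(a)$ is concave on $[0,1]$.
   Context: For $0<a<1$, $\mathcal A_{\rho_0,\rho_1}(a)=\sup_MI(M)$, the supremum over finite POVMs $M=(M_y)$ on $\mathbb C^d$ of the mutual information $I(M)=\sum_y\bigl[au_y\log\frac{u_y}{m_y}+(1-a)v_y\log\frac{v_y}{m_y}\bigr]$ between the letter of the ensemble $\{(a,\rho_0),(1-a,\rho_1)\}$ and the outcome, where $u_y=\mathrm{Tr}(\rho_0M_y)$, $v_y=\mathrm{Tr}(\rho_1M_y)$, $m_y=au_y+(1-a)v_y$ (with $0\log0=0$). At $a\in\{0,1\}$, $\mathcal A_{\rho_0,\rho_1}(a)=0$. The formula for $\Phi$ is literal when $0<a<1$ and $0<R<\mathbf 1$. Elsewhere on $[0,1]\times\{0\preceq R\preceq\mathbf 1\}$ $\Phi$ is defined by upper-semicontinuous closure; for $0<a<1$ this means: the logarithms are compressed to $\mathrm{supp}R$ and $\mathrm{supp}(\mathbf 1-R)$ when $\mathrm{supp}\rho_0\subseteq\mathrm{supp}R$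 and $\mathrm{supp}\rho_1\subseteq\mathrm{supp}(\mathbf 1-R)$, and $\Phi(a,R)=-\infty$ otherwise. *)

theory Defs
  imports "HOL-Analysis.Analysis"
begin

definition herm_adj :: "complex^'n^'m \<Rightarrow> complex^'m^'n" where
  "herm_adj A = (\<chi> i j. cnj (A $ j $ i))"

definition hermitian :: "complex^'n^'n \<Rightarrow> bool" where
  "hermitian A \<longleftrightarrow> herm_adj A = A"

(* The inner product class of HOL-Analysis only provides the real part of this form. *)
definition cdot :: "complex^'n \<Rightarrow> complex^'n \<Rightarrow> complex" where
  "cdot v w = (\<Sum>i\<in>UNIV. cnj (v $ i) * w $ i)"

definition psd :: "complex^'n^'n \<Rightarrow> bool" where
  "psd A \<longleftrightarrow> hermitian A \<and> (\<forall>v. 0 \<le> Re (cdot v (A *v v)))"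

definition posdef :: "complex^'n^'n \<Rightarrow> bool" where
  "posdef A \<longleftrightarrow> hermitian A \<and> (\<forall>v. v \<noteq> 0 \<longrightarrow> 0 < Re (cdot v (A *v v)))"

definition density_op :: "complex^'n^'n \<Rightarrow> bool" where
  "density_op \<rho> \<longleftrightarrow> psd \<rho> \<and> trace \<rho> = 1"

(* All R with 0 <= R <= 1 in the Loewner order. *)
definition effects :: "(complex^'n^'n) set" where
  "effects = {R. psd R \<and> psd (mat 1 - R)}"

definition strict_effects :: "(complex^'n^'n) set" where
  "strict_effects = {R. posdef R \<and> posdef (mat 1 - R)}"

definition supp :: "complex^'n^'n \<Rightarrow> (complex^'n) set" where
  "supp A = {v. \<forall>w. A *v w = 0 \<longrightarrow> cdot w v = 0}"

definition eigenspace :: "complex^'n^'n \<Rightarrow> real \<Rightarrow> (complex^'n) set" where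
  "eigenspace A l = {v. A *v v = complex_of_real l *s v}"

definition eigenvals :: "complex^'n^'n \<Rightarrow> real set" where
  "eigenvals A = {l. \<exists>v. v \<noteq> 0 \<and> v \<in> eigenspace A l}"

(* The orthogonal projection onto the eigenspace. *)
definition eigenproj :: "complex^'n^'n \<Rightarrow> real \<Rightarrow> complex^'n^'n" where
  "eigenproj A l =
     (THE P. hermitian P \<and> P ** P = P \<and> range (\<lambda>v. P *v v) = eigenspace A l)"

(* Spectral functional calculus for a positive semidefinite A.  If A is positive definite,
   0 is not an eigenvalue and this is the logarithm of A.  In general it is the logarithm
   of the compression of A to supp A, extended by zero on the kernel of A. *)
definition matrix_log :: "complex^'n^'n \<Rightarrow> complex^'n^'n" where
  "matrix_log A = (\<Sum>l\<in>eigenvals A - {0}. ln l *\<^sub>R eigenproj A l)"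

definition povm :: "nat set \<Rightarrow> (nat \<Rightarrow> complex^'n^'n) \<Rightarrow> bool" where
  "povm Y M \<longleftrightarrow> finite Y \<and> (\<forall>y\<in>Y. psd (M y)) \<and> (\<Sum>y\<in>Y. M y) = mat 1"

(* The convention 0 log 0 = 0 is automatic since 0 * x = 0; for 0 < a < 1 a vanishing
   denominator forces the corresponding prefactors to vanish too. *)
definition mutual_info ::
  "complex^'n^'n \<Rightarrow> complex^'n^'n \<Rightarrow> real \<Rightarrow> nat set \<Rightarrow> (nat \<Rightarrow> complex^'n^'n) \<Rightarrow> real" where
  "mutual_info \<rho>0 \<rho>1 a Y M =
     (\<Sum>y\<in>Y. let u = Re (trace (\<rho>0 ** M y));
                v = Re (trace (\<rho>1 ** M y));
                m = a * u + (1 - a) * v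
            in a * u * ln (u / m) + (1 - a) * v * ln (v / m))"

(* For density operators and 0 < a < 1 the set is nonempty and bounded above
   (mutual information is at most ln 2), so Sup is the genuine supremum. *)
definition accessible_info :: "complex^'n^'n \<Rightarrow> complex^'n^'n \<Rightarrow> real \<Rightarrow> real" where
  "accessible_info \<rho>0 \<rho>1 a =
     (if 0 < a \<and> a < 1 then Sup {mutual_info \<rho>0 \<rho>1 a Y M | Y M. povm Y M} else 0)"

definition Phi_formula ::
  "complex^'n^'n \<Rightarrow> complex^'n^'n \<Rightarrow> real \<Rightarrow> complex^'n^'n \<Rightarrow> real" where
  "Phi_formula \<rho>0 \<rho>1 a R =
     a * Re (trace (\<rho>0 ** matrix_log ((1 / a) *\<^sub>R R))) +
     (1 - a) * Re (trace (\<rho>1 ** matrix_log ((1 / (1 - a)) *\<^sub>R (mat 1 - R))))"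

(* The formula where 0 < a < 1 and 0 < R < 1, and its upper-semicontinuous closure from
   that region elsewhere. *)
definition Phi ::
  "complex^'n^'n \<Rightarrow> complex^'n^'n \<Rightarrow> real \<Rightarrow> complex^'n^'n \<Rightarrow> ereal" where
  "Phi \<rho>0 \<rho>1 a R =
     (if (a, R) \<in> {0<..<1} \<times> strict_effects then ereal (Phi_formula \<rho>0 \<rho>1 a R)
      else Limsup (at (a, R) within {0<..<1} \<times> strict_effects)
             (\<lambda>(b, S). ereal (Phi_formula \<rho>0 \<rho>1 b S)))"

(* Concavity of an extended-real function; only used for a function that is nowhere
   +infinity, so the left-hand side never has the form infinity - infinity. *)
definition ereal_concave_on :: "'a::real_vector set \<Rightarrow> ('a \<Rightarrow> ereal) \<Rightarrow> bool" where
  "ereal_concave_on C f \<longleftrightarrow> convex C \<and>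
     (\<forall>x\<in>C. \<forall>y\<in>C. \<forall>t. 0 < t \<and> t < 1 \<longrightarrow>
        ereal (1 - t) * f x + ereal t * f y \<le> f ((1 - t) *\<^sub>R x + t *\<^sub>R y))"

end

theory Submission
  imports Defs "HOL-Real_Asymp.Real_Asymp"
begin

text \<open>The upper bound on \<^const>\<open>Phi\<close> is Gibbs' inequality applied to the measurement in the
  eigenbasis of \<open>R\<close>.  Conversely, for a POVM \<open>M\<close> with posteriors \<open>p y\<close> of the first letter,
  the effect \<open>R = (\<Sum>y. p y M y)\<close> is at least as good as \<open>M\<close> by the operator Jensen inequality
  \<open>log (\<Sum>y. p y M y) \<ge> (\<Sum>y. log (p y) M y)\<close>, which follows from the corresponding inequality
  for resolvents, and a compactness argument turns the supremum into a maximum.  The same inequality,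
  applied to spectral projections, shows that \<open>a Tr \<rho> log (R / a)\<close>, the perspective of a concave
  function, is jointly concave.  All boundary questions are handled by replacing \<open>R\<close> and \<open>1 - R\<close> by
  \<open>R + e\<close> and \<open>1 - R + e\<close>: the resulting functions are finite, continuous and concave on the closed
  domain, and \<^const>\<open>Phi\<close> is their infimum over \<open>e > 0\<close>.\<close>

section \<open>Hermitian matrices and the spectral theorem\<close>

text \<open>The logarithm is reached through resolvents: ln x is the integral over s >= 0 of 1/(1+s)
  - 1/(x+s), so an inequality for every resolvent yields one for the logarithm. Taking the trace
  against \<rho> first leaves a real function of s, and no operator-valued integral appears. The
  obstacle is the boundary: \<open>matrix_log\<close> drops the kernel, hence jumps when an
  eigenvalue reaches 0. After a shift by e the kernel is gone, and continuity in the matrix comes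
  from concavity, since a finite concave function on an open set in finite dimension is continuous;
  the eigenprojections themselves may jump when eigenvalues merge. Concavity in a results from
  maximising R out of a jointly concave function. The endpoints a = 0 and a = 1, where the
  accessible information is 0 by definition, are covered by R = 0 and R = 1.\<close>

lemma inner_eq_Re_cdot: "inner v w = Re (cdot v w)"
  by (simp add: inner_vec_def cdot_def inner_complex_def)

lemma matrix_vector_scaleR: "(r *\<^sub>R A) *v v = r *\<^sub>R (A *v (v :: complex^'n))"
  by (simp add: vec_eq_iff matrix_vector_mult_def scaleR_sum_right)

lemma matrix_vector_scaleR_right: "A *v (r *\<^sub>R v) = r *\<^sub>R (A *v (v :: complex^'n))"
  by (simp add: vec_eq_iff matrix_vector_mult_def scaleR_sum_right)

lemma matrix_vector_sum: "(\<Sum>i\<in>I. A i) *v v = (\<Sum>i\<in>I. A i *v (v :: complex^'n))"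
  by (induction I rule: infinite_finite_induct)
     (auto simp: matrix_vector_mult_add_rdistrib)

lemma matrix_mul_scaleR: "A ** (r *\<^sub>R B) = r *\<^sub>R (A ** (B :: complex^'n^'n))"
  by (simp add: vec_eq_iff matrix_matrix_mult_def scaleR_sum_right)

lemma matrix_mul_zero_right: "A ** (0 :: complex^'n^'n) = 0"
  by (simp add: vec_eq_iff matrix_matrix_mult_def)

lemma matrix_mul_sum: "A ** (\<Sum>i\<in>I. B i) = (\<Sum>i\<in>I. A ** (B i :: complex^'n^'n))"
  by (induction I rule: infinite_finite_induct)
     (simp_all add: matrix_add_ldistrib matrix_mul_zero_right)

lemma trace_scaleR: "trace (r *\<^sub>R A) = r *\<^sub>R trace (A :: complex^'n^'n)"
  by (simp add: trace_def scaleR_sum_right)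

lemma trace_sum: "trace (\<Sum>i\<in>I. A i) = (\<Sum>i\<in>I. trace (A i :: complex^'n^'n))"
  by (simp add: trace_def sum.swap[of _ I])

lemma linear_matrix_vector: "linear (\<lambda>v :: complex^'n. A *v v)"
  by (rule linearI) (simp_all add: matrix_vector_right_distrib matrix_vector_scaleR_right)

lemma bounded_linear_matrix_vector: "bounded_linear (\<lambda>v :: complex^'n. A *v v)"
  by (simp add: linear_conv_bounded_linear[symmetric] linear_matrix_vector)

lemma cdot_herm_adj: "cdot (A *v x) y = cdot x (herm_adj A *v (y :: complex^'n))"
  unfolding cdot_def matrix_vector_mult_def herm_adj_def
  by (simp add: sum_distrib_left sum_distrib_right mult_ac) (rule sum.swap)

lemma inner_herm_adj: "inner (A *v x) y = inner x (herm_adj A *v (y :: complex^'n))"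
  by (simp add: inner_eq_Re_cdot cdot_herm_adj)

text \<open>The real part of the complex form is already a nondegenerate inner product, so testing
  against it determines the adjoint. This lets most later arguments work with the real
  \<open>inner\<close> only.\<close>

lemma hermitian_iff_selfadjoint:
  "hermitian (A :: complex^'n^'n) \<longleftrightarrow> (\<forall>x y. inner (A *v x) y = inner x (A *v y))"
proof
  assume "hermitian A"
  thus "\<forall>x y. inner (A *v x) y = inner x (A *v y)"
    by (simp add: inner_herm_adj hermitian_def)
next
  assume *: "\<forall>x y. inner (A *v x) y = inner x (A *v y)"
  have "inner x (herm_adj A *v y - A *v y) = 0" for x y
    using * by (simp add: inner_diff_right inner_herm_adj)
  hence "herm_adj A *v y = A *v y" for y
    by (metis eq_iff_diff_eq_0 inner_eq_zero_iff)
  thus "hermitian A" by (simp add: hermitian_def matrix_eq)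
qed

lemma hermitianD: "hermitian A \<Longrightarrow> inner (A *v x) y = inner x (A *v (y :: complex^'n))"
  by (simp add: hermitian_iff_selfadjoint)

lemma psd_iff: "psd (A :: complex^'n^'n) \<longleftrightarrow> hermitian A \<and> (\<forall>v. 0 \<le> inner v (A *v v))"
  by (simp add: psd_def inner_eq_Re_cdot)

lemma posdef_iff:
  "posdef (A :: complex^'n^'n) \<longleftrightarrow> hermitian A \<and> (\<forall>v. v \<noteq> 0 \<longrightarrow> 0 < inner v (A *v v))"
  by (simp add: posdef_def inner_eq_Re_cdot)

lemma psd_hermitian: "psd A \<Longrightarrow> hermitian A" and posdef_hermitian: "posdef A \<Longrightarrow> hermitian A"
  by (simp_all add: psd_def posdef_def)

lemma posdef_psd: "posdef (A :: complex^'n^'n) \<Longrightarrow> psd A"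
  by (simp add: posdef_iff psd_iff) (metis inner_zero_left less_eq_real_def)

lemma hermitian_add: "hermitian A \<Longrightarrow> hermitian B \<Longrightarrow> hermitian (A + B :: complex^'n^'n)"
  by (simp add: hermitian_iff_selfadjoint matrix_vector_mult_add_rdistrib inner_add_left inner_add_right)

lemma hermitian_diff: "hermitian A \<Longrightarrow> hermitian B \<Longrightarrow> hermitian (A - B :: complex^'n^'n)"
  by (simp add: hermitian_iff_selfadjoint matrix_vector_mult_diff_rdistrib inner_diff_left inner_diff_right)

lemma hermitian_scaleR: "hermitian A \<Longrightarrow> hermitian (r *\<^sub>R A :: complex^'n^'n)"
  by (simp add: hermitian_iff_selfadjoint matrix_vector_scaleR)

lemma hermitian_zero: "hermitian (0 :: complex^'n^'n)"
  by (simp add: hermitian_iff_selfadjoint)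

lemma hermitian_one: "hermitian (mat 1 :: complex^'n^'n)"
  by (simp add: hermitian_iff_selfadjoint)

lemma hermitian_sum: "(\<And>i. i \<in> I \<Longrightarrow> hermitian (A i)) \<Longrightarrow> hermitian (\<Sum>i\<in>I. A i :: complex^'n^'n)"
  by (induction I rule: infinite_finite_induct) (auto simp: hermitian_add hermitian_zero)

lemmas hermitian_intros =
  hermitian_add hermitian_diff hermitian_scaleR hermitian_zero hermitian_one hermitian_sum

lemma psd_add: "psd A \<Longrightarrow> psd B \<Longrightarrow> psd (A + B :: complex^'n^'n)"
  by (simp add: psd_iff hermitian_add matrix_vector_mult_add_rdistrib inner_add_right)

lemma psd_scaleR: "psd A \<Longrightarrow> 0 \<le> r \<Longrightarrow> psd (r *\<^sub>R A :: complex^'n^'n)"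
  by (simp add: psd_iff hermitian_scaleR matrix_vector_scaleR)

lemma psd_zero: "psd (0 :: complex^'n^'n)"
  by (simp add: psd_iff hermitian_zero)

lemma psd_one: "psd (mat 1 :: complex^'n^'n)"
  by (simp add: psd_iff hermitian_one)

lemma psd_sum: "(\<And>i. i \<in> I \<Longrightarrow> psd (A i)) \<Longrightarrow> psd (\<Sum>i\<in>I. A i :: complex^'n^'n)"
  by (induction I rule: infinite_finite_induct) (auto simp: psd_add psd_zero)

lemma posdef_psd_add: "psd A \<Longrightarrow> posdef B \<Longrightarrow> posdef (A + B :: complex^'n^'n)"
  by (simp add: psd_iff posdef_iff hermitian_add matrix_vector_mult_add_rdistrib inner_add_right
      add_nonneg_pos)

lemma posdef_scaleR: "posdef A \<Longrightarrow> 0 < r \<Longrightarrow> posdef (r *\<^sub>R A :: complex^'n^'n)"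
  by (simp add: posdef_iff hermitian_scaleR matrix_vector_scaleR)

lemma posdef_one: "posdef (mat 1 :: complex^'n^'n)"
  by (simp add: posdef_iff hermitian_one)

lemma form_add_scaled:
  fixes B :: "complex^'n^'n"
  assumes "hermitian B"
  shows "inner (u + t *\<^sub>R w) (B *v (u + t *\<^sub>R w)) =
         inner u (B *v u) + 2 * t * inner w (B *v u) + t\<^sup>2 * inner w (B *v w)"
  using hermitianD[OF assms, of u w]
  by (simp add: matrix_vector_right_distrib matrix_vector_scaleR_right inner_add_left
      inner_add_right power2_eq_square algebra_simps inner_commute)

text \<open>First-order condition at a minimum: a quadratic in t that is nonnegative and has no
  constant term has no linear term either. Nonnegativity is asked only along one line, because the
  Rayleigh argument below knows it only on a subspace.\<close>

lemma form_null_orthogonal: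
  fixes B :: "complex^'n^'n"
  assumes "hermitian B" and null: "inner u (B *v u) = 0"
    and nonneg: "\<And>t. 0 \<le> inner (u + t *\<^sub>R w) (B *v (u + t *\<^sub>R w))"
  shows "inner w (B *v u) = 0"
proof (rule ccontr)
  define b where "b = inner w (B *v u)"
  define c where "c = inner w (B *v w)"
  assume "inner w (B *v u) \<noteq> 0"
  hence b: "b \<noteq> 0" by (simp add: b_def)
  have *: "0 \<le> 2 * t * b + t\<^sup>2 * c" for t
    using nonneg[of t] form_add_scaled[OF assms(1), of u t w] null by (simp add: b_def c_def)
  \<comment> \<open>The sign is opposite to b and the size small enough for the linear term to beat
    the quadratic one, whatever the sign of c.\<close>
  define t where "t = - b / (\<bar>c\<bar> + 1)"
  have "2 * t * b + t\<^sup>2 * c = b\<^sup>2 / (\<bar>c\<bar> + 1)\<^sup>2 * (c - 2 * (\<bar>c\<bar> + 1))"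
    by (simp add: t_def divide_simps) (simp add: power2_eq_square algebra_simps)
  also have "\<dots> < 0" using b by (intro mult_pos_neg) (auto simp: add_pos_nonneg)
  finally show False using *[of t] by simp
qed

lemma psd_null:
  fixes A :: "complex^'n^'n"
  assumes "psd A" "inner u (A *v u) = 0"
  shows "A *v u = 0"
  using form_null_orthogonal[of A u "A *v u"] assms by (auto simp: psd_iff)

section \<open>Orthogonal projectors and eigenprojections\<close>

definition orth_projector :: "complex^'n^'n \<Rightarrow> (complex^'n) set \<Rightarrow> bool" where
  "orth_projector P U \<longleftrightarrow> hermitian P \<and> P ** P = P \<and> range (\<lambda>v. P *v v) = U"

lemma orth_projector_fix: "orth_projector P U \<Longrightarrow> u \<in> U \<Longrightarrow> P *v u = u"
  by (auto simp: orth_projector_def matrix_vector_mul_assoc)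

lemma orth_projector_in: "orth_projector P U \<Longrightarrow> P *v u \<in> U"
  by (auto simp: orth_projector_def)

text \<open>Each projector fixes the range of the other, so QP = P and PQ = Q; self-adjointness then
  identifies the two.\<close>

lemma orth_projector_unique:
  assumes "orth_projector P U" "orth_projector Q U"
  shows "P = Q"
proof -
  have "inner x (P *v y) = inner x (Q *v y)" for x y
  proof -
    have "Q *v (P *v y) = P *v y" "P *v (Q *v x) = Q *v x"
      using assms orth_projector_fix orth_projector_in by blast+
    thus ?thesis using assms by (metis hermitianD orth_projector_def)
  qed
  hence "P *v y = Q *v y" for y by (metis eq_iff_diff_eq_0 inner_diff_right inner_eq_zero_iff)
  thus ?thesis by (simp add: matrix_eq)
qed

lemma inner_scalar_mult: "inner (c *s x) y = inner x (cnj c *s (y :: complex^'n))"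
  by (simp add: inner_vec_def inner_complex_def algebra_simps)

text \<open>Real orthogonal decomposition supplies the projection \<open>p\<close>; uniqueness of
  the nearest point makes it additive, and complex linear because \<open>U\<close> is a complex
  subspace, so \<open>p\<close> is given by a matrix.\<close>

lemma orth_projector_exists:
  fixes U :: "(complex^'n) set"
  assumes U: "vec.subspace U"
  shows "\<exists>P. orth_projector P U"
proof -
  have scaleR: "r *\<^sub>R v = complex_of_real r *s v" for r :: real and v :: "complex^'n"
    by (simp add: vec_eq_iff scaleR_conv_of_real[where 'a = complex])
  have sub: "subspace U"
    unfolding subspace_def
  proof (intro conjI ballI allI)
    show "0 \<in> U" using U vec.subspace_0 by blast
    show "x + y \<in> U" if "x \<in> U" "y \<in> U" for x y using U vec.subspace_add that by blast
    show "c *\<^sub>R x \<in> U" if "x \<in> U" for c x using U vec.subspace_scale that scaleR by metis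
  qed
  have "\<exists>u. u \<in> U \<and> (\<forall>w\<in>U. inner w (v - u) = 0)" for v
  proof -
    obtain y z where "y \<in> span U" "\<And>w. w \<in> span U \<Longrightarrow> orthogonal z w" "v = y + z"
      using orthogonal_subspace_decomp_exists[of U v] by metis
    moreover have "span U = U" using sub by simp
    ultimately show ?thesis by (intro exI[of _ y]) (simp add: orthogonal_def inner_commute)
  qed
  then obtain p where pU: "\<And>v. p v \<in> U" and po: "\<And>v w. w \<in> U \<Longrightarrow> inner w (v - p v) = 0"
    by metis
  have uniq: "p v = u" if "u \<in> U" "\<And>w. w \<in> U \<Longrightarrow> inner w (v - u) = 0" for u v
  proof -
    have d: "p v - u \<in> U" using pU that(1) sub by (simp add: subspace_diff)
    have "p v - u = (v - u) - (v - p v)" by simp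
    hence "inner (p v - u) (p v - u) = 0"
      using that(2)[OF d] po[OF d, of v] by (metis inner_diff_right diff_zero)
    thus ?thesis by simp
  qed
  have add: "p (x + y) = p x + p y" for x y
  proof (rule uniq)
    show "p x + p y \<in> U" using pU sub by (simp add: subspace_add)
    show "inner w (x + y - (p x + p y)) = 0" if "w \<in> U" for w
      using po[OF that, of x] po[OF that, of y] by (simp add: inner_diff_right inner_add_right)
  qed
  have scale: "p (c *s x) = c *s p x" for c x
  proof (rule uniq)
    show "c *s p x \<in> U" using pU U by (simp add: vec.subspace_scale)
    show "inner w (c *s x - c *s p x) = 0" if "w \<in> U" for w
    proof -
      \<comment> \<open>The scalar c moves to the other side of the real inner product as
        \<open>cnj c\<close>, which keeps the test vector inside \<open>U\<close>.\<close>
      have "cnj c *s w \<in> U" using that U by (simp add: vec.subspace_scale)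
      from po[OF this, of x] show ?thesis
        by (simp add: inner_scalar_mult vec.scale_right_diff_distrib)
    qed
  qed
  have lin: "Vector_Spaces.linear (*s) (*s) p"
    by unfold_locales (simp_all add: add scale)
  define P where "P = matrix p"
  have Pp: "P *v v = p v" for v unfolding P_def by (rule matrix_works[OF lin])
  have fix_U: "p u = u" if "u \<in> U" for u by (rule uniq) (use that in auto)
  have "inner (p x) y = inner x (p y)" for x y
    using po[OF pU[of x], of y] po[OF pU[of y], of x]
    by (simp add: inner_diff_right inner_commute)
  hence "hermitian P" by (simp add: hermitian_iff_selfadjoint Pp)
  moreover have "P ** P = P"
    by (simp add: matrix_eq matrix_vector_mul_assoc[symmetric] Pp fix_U pU)
  moreover have "range (\<lambda>v. P *v v) = U"
    unfolding Pp using pU fix_U by (auto intro: range_eqI[OF sym])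
  ultimately show ?thesis unfolding orth_projector_def by blast
qed

lemma subspace_eigenspace: "vec.subspace (eigenspace (A :: complex^'n^'n) l)"
  unfolding eigenspace_def
  by (rule vec.subspaceI)
     (auto simp: matrix_vector_right_distrib vec.scale_right_distrib vec.scale mult.commute)

lemma orth_projector_eigenproj: "orth_projector (eigenproj A l) (eigenspace (A :: complex^'n^'n) l)"
proof -
  obtain P where P: "orth_projector P (eigenspace A l)"
    using orth_projector_exists[OF subspace_eigenspace] by blast
  show ?thesis unfolding eigenproj_def orth_projector_def
    by (rule theI[of _ P]) (use P orth_projector_unique in \<open>auto simp: orth_projector_def\<close>)
qed

lemma eigenspace_iff: "v \<in> eigenspace A l \<longleftrightarrow> A *v v = l *\<^sub>R (v :: complex^'n)"
  by (simp add: eigenspace_def vec_eq_iff scaleR_conv_of_real[where 'a = complex])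

lemma eigenproj_hermitian: "hermitian (eigenproj A l :: complex^'n^'n)"
  using orth_projector_eigenproj[of A l] by (simp add: orth_projector_def)

lemma eigenproj_idem: "eigenproj A l *v (eigenproj A l *v v) = eigenproj A l *v (v :: complex^'n)"
  using orth_projector_eigenproj[of A l] by (simp add: orth_projector_def matrix_vector_mul_assoc)

lemma eigenproj_eigen: "A *v (eigenproj A l *v v) = l *\<^sub>R (eigenproj A l *v (v :: complex^'n))"
  using orth_projector_in[OF orth_projector_eigenproj[of A l]] by (simp add: eigenspace_iff)

lemma eigenproj_fix: "A *v v = l *\<^sub>R v \<Longrightarrow> eigenproj A l *v v = (v :: complex^'n)"
  using orth_projector_fix[OF orth_projector_eigenproj[of A l]] by (simp add: eigenspace_iff)

lemma eigenproj_psd: "psd (eigenproj A l :: complex^'n^'n)"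
  unfolding psd_iff
  by (metis eigenproj_hermitian eigenproj_idem hermitianD inner_ge_zero)

lemma eigenspaces_orthogonal:
  fixes A :: "complex^'n^'n"
  assumes "hermitian A" "l \<noteq> m" "A *v v = l *\<^sub>R v" "A *v w = m *\<^sub>R w"
  shows "inner v w = 0"
  using hermitianD[OF assms(1), of v w] assms by simp

text \<open>One eigenvector per eigenvalue gives an orthogonal, hence independent family.\<close>

lemma finite_eigenvals:
  fixes A :: "complex^'n^'n"
  assumes "hermitian A"
  shows "finite (eigenvals A)"
proof -
  have "\<forall>l\<in>eigenvals A. \<exists>v. v \<noteq> 0 \<and> A *v v = l *\<^sub>R v"
    by (auto simp: eigenvals_def eigenspace_iff)
  then obtain e where e: "\<And>l. l \<in> eigenvals A \<Longrightarrow> e l \<noteq> 0 \<and> A *v e l = l *\<^sub>R e l"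
    by metis
  have o: "inner (e l) (e m) = 0" if "l \<in> eigenvals A" "m \<in> eigenvals A" "l \<noteq> m" for l m
    using eigenspaces_orthogonal[OF assms] e that by metis
  hence "inj_on e (eigenvals A)" using e by (metis inj_onI inner_eq_zero_iff)
  moreover have "pairwise orthogonal (e ` eigenvals A)"
    using o by (auto simp: pairwise_def orthogonal_def)
  hence "independent (e ` eigenvals A)"
    using e by (intro pairwise_orthogonal_independent) auto
  hence "finite (e ` eigenvals A)" using independent_imp_finite by blast
  ultimately show ?thesis using finite_imageD by blast
qed

text \<open>On the orthogonal complement of all eigenspaces, a maximiser of the Rayleigh quotient
  would be a further eigenvector.\<close>

lemma eigenspaces_complete:
  fixes A :: "complex^'n^'n"
  assumes A: "hermitian A" and v: "\<And>l w. A *v w = l *\<^sub>R w \<Longrightarrow> inner w v = 0"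
  shows "v = 0"
proof (rule ccontr)
  assume "v \<noteq> 0"
  define U where "U = {u. \<forall>l w. A *v w = l *\<^sub>R w \<longrightarrow> inner w u = 0}"
  have UD: "inner w u = 0" if "u \<in> U" "A *v w = l *\<^sub>R w" for u w l
    using that by (auto simp: U_def)
  have U_add: "u + t *\<^sub>R w \<in> U" if "u \<in> U" "w \<in> U" for u w t
    unfolding U_def
  proof (intro CollectI allI impI)
    fix l x assume "A *v x = l *\<^sub>R x"
    from UD[OF that(1) this] UD[OF that(2) this] show "inner x (u + t *\<^sub>R w) = 0"
      by (simp add: inner_add_right)
  qed
  have U_A: "A *v u \<in> U" if "u \<in> U" for u
  proof -
    have "inner w (A *v u) = 0" if w: "A *v w = l *\<^sub>R w" for w l
      using hermitianD[OF A, of w u] w UD[OF \<open>u \<in> U\<close> w] by simp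
    thus ?thesis by (auto simp: U_def)
  qed
  have zero: "u = 0" if "u \<in> U" "A *v u = l *\<^sub>R u" for u l
    using UD[OF that(1) that(2)] by simp
  have clU: "closed U"
  proof -
    have "U = (\<Inter>w\<in>{w. \<exists>l. A *v w = l *\<^sub>R w}. {u. inner w u = 0})" by (auto simp: U_def)
    thus ?thesis by (auto intro!: closed_INT closed_hyperplane)
  qed
  define K where "K = sphere 0 1 \<inter> U"
  have "compact K" unfolding K_def using clU by (simp add: compact_Int_closed)
  moreover have "(1 / norm v) *\<^sub>R v \<in> K"
    using \<open>v \<noteq> 0\<close> v by (auto simp: K_def U_def)
  hence "K \<noteq> {}" by blast
  moreover have "continuous_on K (\<lambda>u. inner u (A *v u))"
    by (intro continuous_intros bounded_linear.continuous_on[OF bounded_linear_matrix_vector])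
  ultimately obtain u where u: "u \<in> K" "\<And>w. w \<in> K \<Longrightarrow> inner w (A *v w) \<le> inner u (A *v u)"
    using continuous_attains_sup by metis
  define l where "l = inner u (A *v u)"
  \<comment> \<open>As l is the maximum of the Rayleigh quotient on \<open>K\<close>, the form of
    \<open>B\<close> is nonnegative on \<open>U\<close> and vanishes at the maximiser u.\<close>
  define B where "B = l *\<^sub>R mat 1 - A"
  have B: "hermitian B" unfolding B_def by (intro hermitian_intros A)
  have Bv: "B *v w = l *\<^sub>R w - A *v w" for w
    by (simp add: B_def matrix_vector_mult_diff_rdistrib matrix_vector_scaleR)
  have nonneg: "0 \<le> inner w (B *v w)" if "w \<in> U" for w
  proof (cases "w = 0")
    case False
    have "(1 / norm w) *\<^sub>R w \<in> K" using that False by (auto simp: K_def U_def)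
    from u(2)[OF this] have "inner w (A *v w) / (norm w)\<^sup>2 \<le> l"
      by (simp add: l_def matrix_vector_scaleR_right power2_eq_square)
    thus ?thesis using False
      by (simp add: Bv inner_diff_right pos_divide_le_eq power2_norm_eq_inner)
  qed simp
  have uU: "u \<in> U" "norm u = 1" using u(1) by (auto simp: K_def)
  have null: "inner u (B *v u) = 0"
    using uU(2) by (simp add: Bv inner_diff_right l_def norm_eq_1)
  have BuU: "B *v u \<in> U"
    using U_add[OF _ U_A[OF uU(1)], of "l *\<^sub>R u" "-1"] uU(1) by (auto simp: Bv U_def)
  \<comment> \<open>The first-order condition is applied in the direction \<open>B *v u\<close>
    itself, which lies in \<open>U\<close> because \<open>A\<close> maps \<open>U\<close> to
    itself.\<close>
  have "inner (B *v u) (B *v u) = 0"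
    by (rule form_null_orthogonal[OF B null]) (use U_add nonneg uU(1) BuU in blast)
  hence "A *v u = l *\<^sub>R u" by (simp add: Bv)
  with zero uU show False by fastforce
qed

lemma eigenproj_not_eigenval: "l \<notin> eigenvals A \<Longrightarrow> eigenproj A l = (0 :: complex^'n^'n)"
  using orth_projector_in[OF orth_projector_eigenproj[of A l]]
  by (auto simp: eigenvals_def matrix_eq)

lemma eigenproj_orthogonal:
  fixes A :: "complex^'n^'n"
  assumes "hermitian A" "l \<noteq> m" "A *v w = m *\<^sub>R w"
  shows "eigenproj A l *v w = 0"
proof -
  have "inner x (eigenproj A l *v w) = 0" for x
    using eigenspaces_orthogonal[OF assms(1,2) eigenproj_eigen assms(3)]
    by (metis eigenproj_hermitian hermitianD)
  thus ?thesis by (metis inner_eq_zero_iff)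
qed

text \<open>The residual \<open>r\<close> is orthogonal to every eigenvector, since only the
  projector for that eigenvalue sees it; completeness then forces \<open>r = 0\<close>.\<close>

lemma sum_eigenproj_vec:
  fixes A :: "complex^'n^'n"
  assumes A: "hermitian A"
  shows "(\<Sum>l\<in>eigenvals A. eigenproj A l *v v) = v"
proof -
  define r where "r = v - (\<Sum>l\<in>eigenvals A. eigenproj A l *v v)"
  have "inner w r = 0" if w: "A *v w = m *\<^sub>R w" for w m
  proof (cases "w = 0")
    case False
    hence m: "m \<in> eigenvals A" using w by (auto simp: eigenvals_def eigenspace_iff)
    have "inner w (eigenproj A l *v v) = (if l = m then inner w v else 0)" for l
      using eigenproj_orthogonal[OF A _ w, of l] eigenproj_fix[OF w]
        hermitianD[OF eigenproj_hermitian[of A l], of w v] by auto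
    thus ?thesis using m finite_eigenvals[OF A] by (simp add: r_def inner_diff_right inner_sum_right)
  qed simp
  hence "r = 0" by (rule eigenspaces_complete[OF A])
  thus ?thesis by (simp add: r_def)
qed

lemma sum_eigenproj:
  "hermitian A \<Longrightarrow> (\<Sum>l\<in>eigenvals A. eigenproj A l) = (mat 1 :: complex^'n^'n)"
  by (simp add: matrix_eq matrix_vector_sum sum_eigenproj_vec)

lemma spectral_decomp:
  fixes A :: "complex^'n^'n"
  assumes "hermitian A"
  shows "A = (\<Sum>l\<in>eigenvals A. l *\<^sub>R eigenproj A l)"
proof -
  have "A *v v = (\<Sum>l\<in>eigenvals A. l *\<^sub>R (eigenproj A l *v v))" for v
  proof -
    have "A *v v = A *v (\<Sum>l\<in>eigenvals A. eigenproj A l *v v)"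
      by (simp add: sum_eigenproj_vec[OF assms])
    also have "\<dots> = (\<Sum>l\<in>eigenvals A. A *v (eigenproj A l *v v))"
      by (rule linear_sum[OF linear_matrix_vector])
    finally show ?thesis by (simp add: eigenproj_eigen)
  qed
  thus ?thesis by (simp add: matrix_eq matrix_vector_sum matrix_vector_scaleR)
qed

lemma eigenval_form:
  fixes A :: "complex^'n^'n"
  assumes "l \<in> eigenvals A"
  obtains v where "v \<noteq> 0" "inner v (A *v v) = l * inner v v" "inner v v > 0"
  using assms by (auto simp: eigenvals_def eigenspace_iff)

lemma eigenval_nonneg: "psd A \<Longrightarrow> l \<in> eigenvals A \<Longrightarrow> 0 \<le> l"
  by (erule eigenval_form) (metis psd_iff zero_le_mult_iff not_less)

lemma eigenval_pos: "posdef A \<Longrightarrow> l \<in> eigenvals A \<Longrightarrow> 0 < l"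
  by (erule eigenval_form) (metis posdef_iff zero_less_mult_pos2)

lemma column_entry: "(A *v axis i 1) $ j = (A $ j $ i :: complex)"
  by (simp add: matrix_vector_mult_def axis_def if_distrib cong: if_cong)

text \<open>Idempotence and cyclicity turn Tr PB into Tr PBP, a sum of quadratic forms of
  \<open>B\<close>. For positive semidefinite \<open>B\<close> this shows both the sign of the trace
  and what its vanishing means.\<close>

lemma trace_eigenproj_mult:
  fixes A B :: "complex^'n^'n"
  shows "Re (trace (eigenproj A l ** B)) =
           (\<Sum>i\<in>UNIV. inner (eigenproj A l *v axis i 1) (B *v (eigenproj A l *v axis i 1)))"
proof -
  let ?P = "eigenproj A l"
  have idem: "?P ** ?P = ?P"
    by (simp add: matrix_eq matrix_vector_mul_assoc[symmetric] eigenproj_idem)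
  have "trace (?P ** B) = trace (?P ** (?P ** B))" by (simp add: matrix_mul_assoc idem)
  also have "\<dots> = trace ((?P ** B) ** ?P)" by (rule trace_mul_sym)
  finally have "Re (trace (?P ** B)) = (\<Sum>i\<in>UNIV. Re (((?P ** B) ** ?P) $ i $ i))"
    by (simp add: trace_def)
  also have "\<dots> = (\<Sum>i\<in>UNIV. inner (axis i 1) (((?P ** B) ** ?P) *v axis i 1))"
    by (simp add: inner_axis' column_entry)
  also have "\<dots> = (\<Sum>i\<in>UNIV. inner (?P *v axis i 1) (B *v (?P *v axis i 1)))"
    by (simp add: matrix_vector_mul_assoc[symmetric] hermitianD[OF eigenproj_hermitian])
  finally show ?thesis .
qed

lemma trace_mult_nonneg:
  fixes A B :: "complex^'n^'n"
  assumes A: "psd A" and B: "psd B"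
  shows "0 \<le> Re (trace (A ** B))"
proof -
  have "Re (trace (A ** B)) = Re (trace (B ** A))" by (metis trace_mul_sym)
  also have "\<dots> = Re (trace (B ** (\<Sum>l\<in>eigenvals A. l *\<^sub>R eigenproj A l)))"
    by (rule arg_cong[OF spectral_decomp[OF psd_hermitian[OF A]], of "\<lambda>X. Re (trace (B ** X))"])
  also have "\<dots> = (\<Sum>l\<in>eigenvals A. l * Re (trace (B ** eigenproj A l)))"
    by (simp add: matrix_mul_sum matrix_mul_scaleR trace_sum trace_scaleR)
  also have "\<dots> \<ge> 0"
  proof (intro sum_nonneg mult_nonneg_nonneg)
    fix l assume "l \<in> eigenvals A"
    thus "0 \<le> l" using A by (rule eigenval_nonneg[rotated])
    have "0 \<le> Re (trace (eigenproj A l ** B))"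
      unfolding trace_eigenproj_mult using B
      by (intro sum_nonneg) (simp add: psd_iff)
    thus "0 \<le> Re (trace (B ** eigenproj A l))" by (metis trace_mul_sym)
  qed
  finally show ?thesis .
qed

section \<open>The operator Jensen inequality for the logarithm\<close>

definition trace_log :: "complex^'n^'n \<Rightarrow> complex^'n^'n \<Rightarrow> real" where
  "trace_log \<rho> X = Re (trace (\<rho> ** matrix_log X))"

text \<open>For a density operator this is the outcome distribution of the spectral measurement of
  \<open>X\<close>; the weight at 0 is the mass of \<rho> on the kernel of \<open>X\<close>.\<close>

definition spec_weight :: "complex^'n^'n \<Rightarrow> complex^'n^'n \<Rightarrow> real \<Rightarrow> real" where
  "spec_weight \<rho> X l = Re (trace (\<rho> ** eigenproj X l))"

lemma affine_eigen_iff: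
  fixes X :: "complex^'n^'n"
  assumes "\<alpha> \<noteq> 0"
  shows "v \<in> eigenspace (\<alpha> *\<^sub>R X + \<beta> *\<^sub>R mat 1) (\<alpha> * l + \<beta>) \<longleftrightarrow> v \<in> eigenspace X l"
proof -
  have "v \<in> eigenspace (\<alpha> *\<^sub>R X + \<beta> *\<^sub>R mat 1) (\<alpha> * l + \<beta>) \<longleftrightarrow>
        \<alpha> *\<^sub>R (X *v v) = \<alpha> *\<^sub>R (l *\<^sub>R v)"
    by (simp add: eigenspace_iff matrix_vector_mult_add_rdistrib matrix_vector_scaleR scaleR_add_left)
  also have "\<dots> \<longleftrightarrow> X *v v = l *\<^sub>R v" using assms by (metis scaleR_left_imp_eq)
  finally show ?thesis by (simp add: eigenspace_iff)
qed

lemma eigenspace_affine: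
  fixes X :: "complex^'n^'n"
  assumes "\<alpha> \<noteq> 0"
  shows "eigenspace (\<alpha> *\<^sub>R X + \<beta> *\<^sub>R mat 1) (\<alpha> * l + \<beta>) = eigenspace X l"
  using affine_eigen_iff[OF assms] by blast

lemma eigenproj_affine:
  fixes X :: "complex^'n^'n"
  assumes "\<alpha> \<noteq> 0"
  shows "eigenproj (\<alpha> *\<^sub>R X + \<beta> *\<^sub>R mat 1) (\<alpha> * l + \<beta>) = eigenproj X l"
  by (simp add: eigenproj_def eigenspace_affine[OF assms])

lemma eigenvals_affine:
  fixes X :: "complex^'n^'n"
  assumes "\<alpha> \<noteq> 0"
  shows "eigenvals (\<alpha> *\<^sub>R X + \<beta> *\<^sub>R mat 1) = (\<lambda>l. \<alpha> * l + \<beta>) ` eigenvals X"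
proof -
  have "m \<in> eigenvals (\<alpha> *\<^sub>R X + \<beta> *\<^sub>R mat 1) \<longleftrightarrow> (m - \<beta>) / \<alpha> \<in> eigenvals X" for m
    using eigenspace_affine[OF assms, of X \<beta> "(m - \<beta>) / \<alpha>"] assms by (simp add: eigenvals_def)
  moreover have "(m - \<beta>) / \<alpha> \<in> eigenvals X \<longleftrightarrow> m \<in> (\<lambda>l. \<alpha> * l + \<beta>) ` eigenvals X" for m
    using assms by (auto intro!: image_eqI[of _ _ "(m - \<beta>) / \<alpha>"])
  ultimately show ?thesis by blast
qed

text \<open>An affine change moves the eigenvalues and keeps the eigenprojections. Shifts,
  rescalings and the complement of \<open>R\<close> are therefore all expanded over one spectral
  measurement.\<close>

lemma trace_log_affine:
  fixes X :: "complex^'n^'n"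
  assumes "hermitian X" "\<alpha> \<noteq> 0"
  shows "trace_log \<rho> (\<alpha> *\<^sub>R X + \<beta> *\<^sub>R mat 1) =
           (\<Sum>l\<in>eigenvals X. ln (\<alpha> * l + \<beta>) * spec_weight \<rho> X l)"
proof -
  let ?Y = "\<alpha> *\<^sub>R X + \<beta> *\<^sub>R mat 1"
  have "matrix_log ?Y = (\<Sum>m\<in>eigenvals ?Y. ln m *\<^sub>R eigenproj ?Y m)"
    \<comment> \<open>The eigenvalue 0 may be put back into the sum because
      \<open>ln 0 = 0\<close>.\<close>
    unfolding matrix_log_def
    by (rule sum.mono_neutral_left)
       (auto intro!: finite_eigenvals hermitian_intros assms)
  also have "\<dots> = (\<Sum>l\<in>eigenvals X. ln (\<alpha> * l + \<beta>) *\<^sub>R eigenproj ?Y (\<alpha> * l + \<beta>))"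
    unfolding eigenvals_affine[OF assms(2)]
    by (rule sum.reindex_cong[of "\<lambda>l. \<alpha> * l + \<beta>"]) (auto intro!: inj_onI simp: assms(2))
  finally show ?thesis
    by (simp add: trace_log_def spec_weight_def eigenproj_affine[OF assms(2)] matrix_mul_sum
        matrix_mul_scaleR trace_sum trace_scaleR)
qed

lemma trace_log_shift:
  "hermitian X \<Longrightarrow> trace_log \<rho> (X + \<beta> *\<^sub>R mat 1) = (\<Sum>l\<in>eigenvals X. ln (l + \<beta>) * spec_weight \<rho> X l)"
  using trace_log_affine[of X 1 \<rho> \<beta>] by simp

lemma trace_log_scale:
  "hermitian X \<Longrightarrow> \<alpha> \<noteq> 0 \<Longrightarrow>
    trace_log \<rho> (\<alpha> *\<^sub>R X) = (\<Sum>l\<in>eigenvals X. ln (\<alpha> * l) * spec_weight \<rho> X l)"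
  using trace_log_affine[of X \<alpha> \<rho> 0] by simp

lemma trace_log_spec:
  "hermitian X \<Longrightarrow> trace_log \<rho> X = (\<Sum>l\<in>eigenvals X. ln l * spec_weight \<rho> X l)"
  using trace_log_affine[of X 1 \<rho> 0] by simp

lemma spec_weight_nonneg: "psd \<rho> \<Longrightarrow> 0 \<le> spec_weight \<rho> X l"
  unfolding spec_weight_def by (rule trace_mult_nonneg) (simp_all add: eigenproj_psd)

lemma spec_weight_not_eigenval: "l \<notin> eigenvals X \<Longrightarrow> spec_weight \<rho> X l = 0"
  by (simp add: spec_weight_def eigenproj_not_eigenval matrix_mul_zero_right) (simp add: trace_def)

lemma trace_mult_sum:
  fixes \<rho> :: "complex^'n^'n"
  shows "Re (trace (\<rho> ** (\<Sum>i\<in>I. r i *\<^sub>R M i))) = (\<Sum>i\<in>I. r i * Re (trace (\<rho> ** M i)))"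
  by (simp add: matrix_mul_sum matrix_mul_scaleR trace_sum trace_scaleR)

lemma trace_mult_sum_one:
  assumes "(\<Sum>i\<in>I. M i) = mat 1"
  shows "(\<Sum>i\<in>I. Re (trace (\<rho> ** M i))) = Re (trace \<rho>)"
  using trace_mult_sum[of \<rho> "\<lambda>_. 1" M I] by (simp add: assms)

lemma sum_spec_weight:
  "hermitian X \<Longrightarrow> (\<Sum>l\<in>eigenvals X. spec_weight \<rho> X l) = Re (trace \<rho>)"
  unfolding spec_weight_def by (rule trace_mult_sum_one) (rule sum_eigenproj)

text \<open>Completing the square in each \<^term>\<open>M i\<close> at the vector \<^term>\<open>v - (p i + s) *\<^sub>R w\<close>, where
  \<^term>\<open>w\<close> is the resolvent of \<^term>\<open>X\<close> applied to \<^term>\<open>v\<close>.\<close>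

lemma resolvent_jensen:
  fixes X :: "complex^'n^'n"
  assumes X: "posdef X"
    and M: "\<And>i. i \<in> I \<Longrightarrow> psd (M i)" "(\<Sum>i\<in>I. M i) = mat 1"
    and p: "\<And>i. i \<in> I \<Longrightarrow> 0 < p i" and le: "psd (X - (\<Sum>i\<in>I. p i *\<^sub>R M i))"
    and s: "0 \<le> s"
  shows "psd ((\<Sum>i\<in>I. (1 / (p i + s)) *\<^sub>R M i) - (\<Sum>l\<in>eigenvals X. (1 / (l + s)) *\<^sub>R eigenproj X l))"
  unfolding psd_iff
proof (intro conjI allI)
  show "hermitian ((\<Sum>i\<in>I. (1 / (p i + s)) *\<^sub>R M i) - (\<Sum>l\<in>eigenvals X. (1 / (l + s)) *\<^sub>R eigenproj X l))"
    by (intro hermitian_intros psd_hermitian M eigenproj_psd)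
next
  fix v :: "complex^'n"
  note hX = posdef_hermitian[OF X]
  define w where "w = (\<Sum>l\<in>eigenvals X. (1 / (l + s)) *\<^sub>R (eigenproj X l *v v))"
  have "X *v w + s *\<^sub>R w = (\<Sum>l\<in>eigenvals X. ((l + s) / (l + s)) *\<^sub>R (eigenproj X l *v v))"
    by (simp add: w_def linear_sum[OF linear_matrix_vector] matrix_vector_scaleR_right eigenproj_eigen
        scaleR_sum_right flip: sum.distrib scaleR_add_left add_divide_distrib)
  also have "\<dots> = (\<Sum>l\<in>eigenvals X. eigenproj X l *v v)"
    using eigenval_pos[OF X] s by (intro sum.cong refl) (force simp: add_pos_nonneg)
  finally have Xw: "X *v w + s *\<^sub>R w = v" by (simp add: sum_eigenproj_vec[OF hX])
  have sum_form: "inner x ((\<Sum>i\<in>I. r i *\<^sub>R M i) *v y) = (\<Sum>i\<in>I. r i * inner x (M i *v y))" for x y r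
    by (simp add: matrix_vector_sum matrix_vector_scaleR inner_sum_right)
  have one: "(\<Sum>i\<in>I. inner x (M i *v y)) = inner x y" for x y
    using sum_form[of x "\<lambda>_. 1" y] by (simp add: M(2))
  have square: "(1 / (p i + s)) * inner v (M i *v v)
      \<ge> 2 * inner w (M i *v v) - (p i * inner w (M i *v w) + s * inner w (M i *v w))"
    if i: "i \<in> I" for i
  proof -
    have pos: "0 < p i + s" using p[OF i] s by simp
    have "0 \<le> inner (v + (- (p i + s)) *\<^sub>R w) (M i *v (v + (- (p i + s)) *\<^sub>R w))"
      using M(1)[OF i] psd_iff by blast
    also have "\<dots> = inner v (M i *v v) - 2 * (p i + s) * inner w (M i *v v) +
        (p i + s)\<^sup>2 * inner w (M i *v w)"
      by (subst form_add_scaled[OF psd_hermitian[OF M(1)[OF i]]])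
         (simp add: power2_eq_square algebra_simps)
    finally have "0 \<le> (1 / (p i + s)) * (inner v (M i *v v) - 2 * (p i + s) * inner w (M i *v v) +
        (p i + s)\<^sup>2 * inner w (M i *v w))"
      using pos by (intro mult_nonneg_nonneg) auto
    also have "\<dots> = (1 / (p i + s)) * inner v (M i *v v) - 2 * inner w (M i *v v)
        + (p i + s) * inner w (M i *v w)"
      using pos by (simp add: field_simps power2_eq_square)
    finally show ?thesis by (simp add: algebra_simps)
  qed
  have "(\<Sum>i\<in>I. 2 * inner w (M i *v v) - (p i * inner w (M i *v w) + s * inner w (M i *v w)))
      \<le> (\<Sum>i\<in>I. (1 / (p i + s)) * inner v (M i *v v))"
    by (intro sum_mono square)
  hence "2 * inner w v - (inner w ((\<Sum>i\<in>I. p i *\<^sub>R M i) *v w) + s * inner w w)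
      \<le> (\<Sum>i\<in>I. (1 / (p i + s)) * inner v (M i *v v))"
    by (simp add: sum_subtractf sum.distrib one sum_form flip: sum_distrib_left)
  \<comment> \<open>Domination by \<open>X\<close> enters here: replacing the mixture by
    \<open>X\<close> turns the left-hand side into 2 <w,v> - <w,(X+s)w>, which equals <w,v>.\<close>
  moreover have "0 \<le> inner w (X *v w) - inner w ((\<Sum>i\<in>I. p i *\<^sub>R M i) *v w)"
    using le by (simp add: psd_iff matrix_vector_mult_diff_rdistrib inner_diff_right)
  moreover have "inner w (X *v w) + s * inner w w = inner w v"
    using Xw by (metis inner_add_right inner_scaleR_right)
  ultimately have "inner v w \<le> (\<Sum>i\<in>I. (1 / (p i + s)) * inner v (M i *v v))"
    by (simp add: inner_commute)
  thus "0 \<le> inner v (((\<Sum>i\<in>I. (1 / (p i + s)) *\<^sub>R M i) -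
      (\<Sum>l\<in>eigenvals X. (1 / (l + s)) *\<^sub>R eigenproj X l)) *v v)"
    by (simp add: matrix_vector_mult_diff_rdistrib inner_diff_right sum_form)
       (simp add: w_def matrix_vector_sum matrix_vector_scaleR)
qed

text \<open>Integrating the resolvent inequality over \<^term>\<open>s \<ge> (0::real)\<close>: the difference of
  the shifted logarithms is monotone in the shift and tends to zero.\<close>

lemma log_jensen:
  fixes X :: "complex^'n^'n"
  assumes \<rho>: "psd \<rho>" and X: "posdef X"
    and M: "\<And>i. i \<in> I \<Longrightarrow> psd (M i)" "(\<Sum>i\<in>I. M i) = mat 1"
    and p: "\<And>i. i \<in> I \<Longrightarrow> 0 < p i" and le: "psd (X - (\<Sum>i\<in>I. p i *\<^sub>R M i))"
  shows "(\<Sum>i\<in>I. ln (p i) * Re (trace (\<rho> ** M i))) \<le> trace_log \<rho> X"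
proof -
  note hX = posdef_hermitian[OF X]
  define d where "d i = Re (trace (\<rho> ** M i))" for i
  define c where "c = spec_weight \<rho> X"
  define E where "E = eigenvals X"
  have E: "0 < l" if "l \<in> E" for l using eigenval_pos[OF X] that by (simp add: E_def)
  define g where "g s = (\<Sum>l\<in>E. c l * ln (l + s)) - (\<Sum>i\<in>I. d i * ln (p i + s))" for s
  have decr: "(\<Sum>l\<in>E. c l / (l + s)) \<le> (\<Sum>i\<in>I. d i / (p i + s))" if "0 \<le> s" for s
  proof -
    have "0 \<le> Re (trace (\<rho> ** ((\<Sum>i\<in>I. (1 / (p i + s)) *\<^sub>R M i) -
        (\<Sum>l\<in>E. (1 / (l + s)) *\<^sub>R eigenproj X l))))"
      unfolding E_def by (intro trace_mult_nonneg \<rho> resolvent_jensen X M p le that)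
    also have "\<dots> = (\<Sum>i\<in>I. d i / (p i + s)) - (\<Sum>l\<in>E. c l / (l + s))"
    proof -
      have diff: "A ** (B - C) = A ** B - A ** C" for A B C :: "complex^'n^'n"
        by (simp add: vec_eq_iff matrix_matrix_mult_def algebra_simps sum_subtractf)
      show ?thesis
        by (simp add: diff trace_sub trace_mult_sum) (simp add: d_def c_def spec_weight_def)
    qed
    finally show ?thesis by simp
  qed
  have mono: "g s \<le> g 0" if "0 \<le> s" for s
  proof (rule DERIV_nonpos_imp_nonincreasing[OF that])
    fix x :: real assume x: "0 \<le> x"
    have "(g has_real_derivative ((\<Sum>l\<in>E. c l * (1 / (l + x))) - (\<Sum>i\<in>I. d i * (1 / (p i + x))))) (at x)"
      unfolding g_def using x p E
      by (intro derivative_intros DERIV_sum DERIV_cmult) (auto intro!: derivative_eq_intros simp: add_pos_nonneg)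
    thus "\<exists>y. (g has_real_derivative y) (at x) \<and> y \<le> 0" using decr[OF x] by auto
  qed
  \<comment> \<open>Equal total weights allow \<open>ln s\<close> to be subtracted from every term
    of \<open>g s\<close> without changing it, and each term then tends to 0.\<close>
  have sums: "(\<Sum>l\<in>E. c l) = (\<Sum>i\<in>I. d i)"
    by (simp add: E_def c_def d_def sum_spec_weight[OF hX] trace_mult_sum_one[OF M(2)])
  have "((\<lambda>s. (\<Sum>l\<in>E. c l * (ln (l + s) - ln s)) - (\<Sum>i\<in>I. d i * (ln (p i + s) - ln s)))
      \<longlongrightarrow> (\<Sum>l\<in>E. c l * 0) - (\<Sum>i\<in>I. d i * 0)) at_top"
  proof -
    have "((\<lambda>s. ln (l + s) - ln s) \<longlongrightarrow> 0) at_top" for l :: real by real_asymp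
    thus ?thesis by (intro tendsto_diff tendsto_sum tendsto_mult_left)
  qed
  moreover have "(\<Sum>l\<in>E. c l * (ln (l + s) - ln s)) - (\<Sum>i\<in>I. d i * (ln (p i + s) - ln s)) = g s" for s
    by (simp add: g_def right_diff_distrib sum_subtractf sums flip: sum_distrib_right)
  ultimately have "(g \<longlongrightarrow> 0) at_top" by simp
  moreover have "\<forall>\<^sub>F s in at_top. g s \<le> g 0"
    using mono eventually_at_top_linorder by blast
  ultimately have "0 \<le> g 0" by (intro tendsto_upperbound[of g 0 at_top]) auto
  thus ?thesis by (simp add: g_def trace_log_spec[OF hX] d_def c_def E_def mult.commute)
qed

text \<open>The POVM performs the spectral measurement of \<open>X0\<close> or of \<open>X1\<close>
  with probabilities \<theta>0 and \<theta>1, weighted by the eigenvalues found. The sum type keeps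
  the two apart even if they share eigenvalues. Concavity and operator monotonicity are both special
  cases.\<close>

lemma trace_log_superconcave:
  fixes X0 X1 X :: "complex^'n^'n"
  assumes \<rho>: "density_op \<rho>" and X: "posdef X0" "posdef X1" "posdef X"
    and t: "0 \<le> \<theta>0" "0 \<le> \<theta>1" "\<theta>0 + \<theta>1 = 1"
    and le: "psd (X - (\<theta>0 *\<^sub>R X0 + \<theta>1 *\<^sub>R X1))"
  shows "\<theta>0 * trace_log \<rho> X0 + \<theta>1 * trace_log \<rho> X1 \<le> trace_log \<rho> X"
proof -
  note h = posdef_hermitian[OF X(1)] posdef_hermitian[OF X(2)]
  define M where "M = case_sum (\<lambda>l. \<theta>0 *\<^sub>R eigenproj X0 l) (\<lambda>l. \<theta>1 *\<^sub>R eigenproj X1 l)"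
  define p :: "real + real \<Rightarrow> real" where "p = case_sum id id"
  define I where "I = eigenvals X0 <+> eigenvals X1"
  have fin: "finite (eigenvals X0)" "finite (eigenvals X1)" using h by (simp_all add: finite_eigenvals)
  have sumI: "sum f I = (\<Sum>l\<in>eigenvals X0. f (Inl l)) + (\<Sum>l\<in>eigenvals X1. f (Inr l))"
    for f :: "real + real \<Rightarrow> 'b::comm_monoid_add"
    unfolding I_def using fin by (simp add: sum.Plus)
  have "(\<Sum>i\<in>I. ln (p i) * Re (trace (\<rho> ** M i))) \<le> trace_log \<rho> X"
  proof (rule log_jensen)
    show "psd \<rho>" using \<rho> by (simp add: density_op_def)
    show "posdef X" by fact
    show "psd (M i)" if "i \<in> I" for i
      using that t by (auto simp: M_def I_def intro!: psd_scaleR eigenproj_psd)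
    show "(\<Sum>i\<in>I. M i) = mat 1"
      using t(3) by (simp add: sumI M_def sum_eigenproj h flip: scaleR_sum_right scaleR_add_left)
    show "0 < p i" if "i \<in> I" for i
      using that eigenval_pos X by (auto simp: p_def I_def)
    have "(\<Sum>i\<in>I. p i *\<^sub>R M i) = \<theta>0 *\<^sub>R (\<Sum>l\<in>eigenvals X0. l *\<^sub>R eigenproj X0 l) +
        \<theta>1 *\<^sub>R (\<Sum>l\<in>eigenvals X1. l *\<^sub>R eigenproj X1 l)"
      by (simp add: sumI p_def M_def scaleR_sum_right mult.commute)
    thus "psd (X - (\<Sum>i\<in>I. p i *\<^sub>R M i))"
      using le by (simp flip: spectral_decomp[OF h(1)] spectral_decomp[OF h(2)])
  qed
  thus ?thesis
    by (simp add: sumI p_def M_def trace_log_spec h matrix_mul_scaleR trace_scaleR spec_weight_def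
        sum_distrib_left mult_ac)
qed

text \<open>Hermiticity is left out because Hermitian matrices form a proper real subspace, which is
  not open. The complement is closed as a projection along the compact unit sphere.\<close>

lemma open_positive_forms: "open {A :: complex^'n^'n. \<forall>v. v \<noteq> 0 \<longrightarrow> 0 < inner v (A *v v)}"
proof -
  define K where "K = {x :: (complex^'n) \<times> (complex^'n^'n). inner (fst x) (snd x *v fst x) \<le> 0}"
  have eq: "- {A :: complex^'n^'n. \<forall>v. v \<noteq> 0 \<longrightarrow> 0 < inner v (A *v v)} =
        {A. \<exists>v. (v :: complex^'n) \<in> sphere 0 1 \<and> (v, A) \<in> K}"
  proof (intro equalityI subsetI; clarsimp simp: K_def not_less)
    fix A and v :: "complex^'n" assume v: "v \<noteq> 0" "inner v (A *v v) \<le> 0"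
    thus "\<exists>v. norm v = 1 \<and> inner v (A *v v) \<le> 0"
      by (intro exI[of _ "(1 / norm v) *\<^sub>R v"])
         (simp add: matrix_vector_scaleR_right divide_nonpos_nonneg)
  next
    fix A and v :: "complex^'n" assume "norm v = 1" "inner v (A *v v) \<le> 0"
    thus "\<exists>v. v \<noteq> 0 \<and> inner v (A *v v) \<le> 0" by (intro exI[of _ v]) auto
  qed
  have "closed K" unfolding K_def matrix_vector_mult_def
    by (intro closed_Collect_le continuous_intros)
  hence "closed {A. \<exists>v. (v :: complex^'n) \<in> sphere 0 1 \<and> (v, A) \<in> K}"
    by (intro closed_compact_projection) auto
  thus ?thesis unfolding eq[symmetric] closed_def by simp
qed

text \<open>Convex functions on open sets are continuous. To obtain an open domain, the function is
  composed with the Hermitian part \<open>h\<close>, which leaves the real quadratic form unchanged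
  and fixes Hermitian matrices.\<close>

lemma continuous_on_trace_log:
  fixes \<rho> :: "complex^'n^'n"
  assumes \<rho>: "density_op \<rho>"
  shows "continuous_on {X. posdef X} (trace_log \<rho>)"
proof -
  define h :: "complex^'n^'n \<Rightarrow> complex^'n^'n" where "h A = (1/2) *\<^sub>R (A + herm_adj A)" for A
  define S :: "(complex^'n^'n) set" where "S = {A. \<forall>v. v \<noteq> 0 \<longrightarrow> 0 < inner v (A *v v)}"
  have hv: "h A *v v = (1/2) *\<^sub>R (A *v v + herm_adj A *v v)" for A v
    by (simp add: h_def matrix_vector_scaleR matrix_vector_mult_add_rdistrib)
  have hform: "inner v (h A *v v) = inner v (A *v v)" for A v
    using inner_herm_adj[of A v v] by (simp add: hv inner_add_right inner_commute)
  have adj: "inner (herm_adj A *v x) y = inner x (A *v y)" for A :: "complex^'n^'n" and x y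
    using inner_herm_adj[of A y x] by (simp add: inner_commute)
  have "hermitian (h A)" for A
    unfolding hermitian_iff_selfadjoint
    by (simp add: hv inner_add_left inner_add_right inner_herm_adj[of A] adj)
  hence hS: "posdef (h A)" if "A \<in> S" for A using that by (simp add: posdef_iff hform S_def)
  have hmix: "h (u *\<^sub>R A + v *\<^sub>R B) = u *\<^sub>R h A + v *\<^sub>R h B" for u v A B
    by (simp add: h_def herm_adj_def vec_eq_iff algebra_simps)
  have mixS: "u *\<^sub>R A + v *\<^sub>R B \<in> S" if "A \<in> S" "B \<in> S" "0 \<le> u" "0 \<le> v" "u + v = 1" for u v A B
  proof -
    have "0 < u * a + v * b" if "0 < a" "0 < b" for a b :: real
      using that \<open>0 \<le> u\<close> \<open>0 \<le> v\<close> \<open>u + v = 1\<close>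
      by (cases "u = 0") (auto intro!: add_pos_nonneg)
    thus ?thesis using that
      by (auto simp: S_def matrix_vector_mult_add_rdistrib matrix_vector_scaleR inner_add_right)
  qed
  have "convex_on S (\<lambda>A. - trace_log \<rho> (h A))"
    unfolding convex_on_def
  proof (intro conjI ballI allI impI)
    show "convex S" using mixS by (auto simp: convex_def)
    fix A B and u v :: real assume *: "A \<in> S" "B \<in> S" "0 \<le> u" "0 \<le> v" "u + v = 1"
    have "u * trace_log \<rho> (h A) + v * trace_log \<rho> (h B) \<le> trace_log \<rho> (h (u *\<^sub>R A + v *\<^sub>R B))"
      using * hS[OF mixS[OF *]] hS
      by (intro trace_log_superconcave \<rho>) (simp_all add: hmix psd_zero)
    thus "- trace_log \<rho> (h (u *\<^sub>R A + v *\<^sub>R B)) \<le> u * - trace_log \<rho> (h A) + v * - trace_log \<rho> (h B)"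
      by simp
  qed
  moreover have "open S" unfolding S_def by (rule open_positive_forms)
  ultimately have "continuous_on S (\<lambda>A. - trace_log \<rho> (h A))"
    using convex_on_continuous by blast
  hence "continuous_on S (\<lambda>A. trace_log \<rho> (h A))"
    using continuous_on_minus by fastforce
  hence "continuous_on {X. posdef X} (\<lambda>A. trace_log \<rho> (h A))"
    by (rule continuous_on_subset) (auto simp: S_def posdef_iff)
  moreover have "trace_log \<rho> (h X) = trace_log \<rho> X" if "X \<in> {X. posdef X}" for X
    using that by (simp add: h_def posdef_iff hermitian_def scaleR_2[symmetric])
  ultimately show ?thesis by (rule continuous_on_eq)
qed

section \<open>Support conditions and regularisation by a positive shift\<close>

lemma eigenval_le_one:
  fixes X :: "complex^'n^'n"
  assumes "psd (mat 1 - X)" "l \<in> eigenvals X"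
  shows "l \<le> 1"
  using assms(2)
proof (rule eigenval_form)
  fix v assume v: "inner v (X *v v) = l * inner v v" "inner v v > 0"
  have "0 \<le> inner v ((mat 1 - X) *v v)" using assms(1) by (simp add: psd_iff)
  also have "\<dots> = (1 - l) * inner v v"
    by (simp add: matrix_vector_mult_diff_rdistrib inner_diff_right v(1) left_diff_distrib)
  finally show "l \<le> 1" using v(2) by (simp add: zero_le_mult_iff)
qed

lemma effects_psd: "R \<in> effects \<Longrightarrow> psd R" "R \<in> effects \<Longrightarrow> psd (mat 1 - R)"
  by (simp_all add: effects_def)

lemma complement_effects: "R \<in> effects \<Longrightarrow> mat 1 - R \<in> effects"
  by (simp add: effects_def)

text \<open>For Hermitian \<rho> the range lies in the support, so the inclusion says that the
  kernel projection of \<open>R\<close> annihilates \<rho>. Since \<rho> is positive semidefinite,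
  the trace detects this, which makes the support convention a scalar condition.\<close>

lemma supp_subset_iff:
  fixes \<rho> R :: "complex^'n^'n"
  assumes \<rho>: "psd \<rho>"
  shows "supp \<rho> \<subseteq> supp R \<longleftrightarrow> spec_weight \<rho> R 0 = 0"
proof
  let ?P = "eigenproj R 0"
  assume sub: "supp \<rho> \<subseteq> supp R"
  have "inner x (?P *v (\<rho> *v v)) = 0" for x v
  proof -
    have "cdot w (\<rho> *v v) = 0" if "\<rho> *v w = 0" for w
      using cdot_herm_adj[of \<rho> w v] psd_hermitian[OF \<rho>] that by (simp add: hermitian_def cdot_def)
    hence "\<rho> *v v \<in> supp R" using sub by (auto simp: supp_def)
    hence "cdot (?P *v x) (\<rho> *v v) = 0" using eigenproj_eigen[of R 0 x] by (simp add: supp_def)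
    hence "inner (?P *v x) (\<rho> *v v) = 0" by (simp add: inner_eq_Re_cdot)
    thus ?thesis by (simp add: hermitianD[OF eigenproj_hermitian])
  qed
  hence "?P *v (\<rho> *v v) = 0" for v by (metis inner_eq_zero_iff)
  hence "?P ** \<rho> = 0" by (simp add: matrix_eq flip: matrix_vector_mul_assoc)
  thus "spec_weight \<rho> R 0 = 0"
    unfolding spec_weight_def by (subst trace_mul_sym) (simp add: trace_def)
next
  let ?P = "eigenproj R 0"
  assume "spec_weight \<rho> R 0 = 0"
  hence "Re (trace (?P ** \<rho>)) = 0" unfolding spec_weight_def by (subst trace_mul_sym) simp
  hence "inner (?P *v axis i 1) (\<rho> *v (?P *v axis i 1)) = 0" for i
    \<comment> \<open>A vanishing sum of nonnegative forms vanishes termwise;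
      \<open>psd_null\<close> then upgrades a zero of the form to a kernel vector.\<close>
    unfolding trace_eigenproj_mult using \<rho> by (subst (asm) sum_nonneg_eq_0_iff) (auto simp: psd_iff)
  hence "(\<rho> ** ?P) *v axis i 1 = 0" for i
    using psd_null[OF \<rho>] by (simp flip: matrix_vector_mul_assoc)
  hence "(\<rho> ** ?P) $ j $ i = 0" for i j by (metis column_entry zero_index)
  hence \<rho>P: "\<rho> ** ?P = 0" by (simp add: vec_eq_iff)
  have "\<rho> *v w = 0" if "R *v w = 0" for w
  proof -
    have "?P *v w = w" using that by (intro eigenproj_fix) simp
    thus ?thesis using \<rho>P by (metis matrix_vector_mul_assoc matrix_vector_mult_0)
  qed
  thus "supp \<rho> \<subseteq> supp R" by (auto simp: supp_def)
qed

lemma spec_weight_posdef: "posdef R \<Longrightarrow> spec_weight \<rho> R 0 = 0"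
  using eigenval_pos[of R 0] by (auto intro: spec_weight_not_eigenval)

text \<open>The product rule for \<open>ln\<close> fails at eigenvalue 0, where
  \<open>ln 0 = 0\<close>; the vanishing kernel weight removes that term, and the unit trace
  collects the constant.\<close>

lemma trace_log_scale_pos:
  assumes X: "psd X" and w: "spec_weight \<rho> X 0 = 0" and \<alpha>: "0 < \<alpha>" and \<rho>: "Re (trace \<rho>) = 1"
  shows "trace_log \<rho> (\<alpha> *\<^sub>R X) = ln \<alpha> + trace_log \<rho> X"
proof -
  note h = psd_hermitian[OF X]
  have "ln (\<alpha> * l) * spec_weight \<rho> X l = ln \<alpha> * spec_weight \<rho> X l + ln l * spec_weight \<rho> X l"
    if "l \<in> eigenvals X" for l
    using eigenval_nonneg[OF X that] \<alpha> w by (cases "l = 0") (simp_all add: ln_mult_pos distrib_right)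
  hence "(\<Sum>l\<in>eigenvals X. ln (\<alpha> * l) * spec_weight \<rho> X l) =
        (\<Sum>l\<in>eigenvals X. ln \<alpha> * spec_weight \<rho> X l + ln l * spec_weight \<rho> X l)"
    by (intro sum.cong refl)
  thus ?thesis using \<alpha>
    by (simp add: trace_log_spec[OF h] trace_log_scale[OF h] sum.distrib sum_spec_weight[OF h] \<rho>
        flip: sum_distrib_left)
qed

lemma trace_log_shift_ge:
  assumes X: "psd X" and w: "spec_weight \<rho> X 0 = 0" and \<rho>: "psd \<rho>" and e: "0 < e"
  shows "trace_log \<rho> X \<le> trace_log \<rho> (X + e *\<^sub>R mat 1)"
  unfolding trace_log_spec[OF psd_hermitian[OF X]] trace_log_shift[OF psd_hermitian[OF X]]
proof (rule sum_mono)
  fix l assume "l \<in> eigenvals X"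
  with X have "0 \<le> l" by (rule eigenval_nonneg)
  thus "ln l * spec_weight \<rho> X l \<le> ln (l + e) * spec_weight \<rho> X l"
    using e w by (cases "l = 0") (auto intro!: mult_right_mono spec_weight_nonneg \<rho>)
qed

lemma trace_log_shift_mono:
  assumes X: "psd X" and \<rho>: "psd \<rho>" and e: "0 < e" "e \<le> e'"
  shows "trace_log \<rho> (X + e *\<^sub>R mat 1) \<le> trace_log \<rho> (X + e' *\<^sub>R mat 1)"
  unfolding trace_log_shift[OF psd_hermitian[OF X]]
  using eigenval_nonneg[OF X] e
  by (intro sum_mono mult_right_mono spec_weight_nonneg \<rho>) (simp add: add_nonneg_pos)

lemma trace_log_shift_le:
  assumes X: "X \<in> effects" and \<rho>: "density_op \<rho>" and e: "0 < e"
  shows "trace_log \<rho> (X + e *\<^sub>R mat 1) \<le> ln (1 + e)"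
proof -
  note h = psd_hermitian[OF effects_psd(1)[OF X]]
  have "trace_log \<rho> (X + e *\<^sub>R mat 1) \<le> (\<Sum>l\<in>eigenvals X. ln (1 + e) * spec_weight \<rho> X l)"
    unfolding trace_log_shift[OF h] using \<rho>
    by (intro sum_mono mult_right_mono spec_weight_nonneg)
       (auto simp: density_op_def eigenval_nonneg[OF effects_psd(1)[OF X]] add_nonneg_pos e
         eigenval_le_one[OF effects_psd(2)[OF X]])
  also have "\<dots> = ln (1 + e)"
    using \<rho> by (simp add: sum_spec_weight[OF h] density_op_def flip: sum_distrib_left)
  finally show ?thesis .
qed

lemma trace_log_shift_tendsto:
  assumes X: "psd X" and w: "spec_weight \<rho> X 0 = 0"
  shows "((\<lambda>e. trace_log \<rho> (X + e *\<^sub>R mat 1)) \<longlongrightarrow> trace_log \<rho> X) (at_right 0)"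
  unfolding trace_log_spec[OF psd_hermitian[OF X]] trace_log_shift[OF psd_hermitian[OF X]]
proof (rule tendsto_sum)
  fix l assume "l \<in> eigenvals X"
  with X have "0 \<le> l" by (rule eigenval_nonneg)
  show "((\<lambda>e. ln (l + e) * spec_weight \<rho> X l) \<longlongrightarrow> ln l * spec_weight \<rho> X l) (at_right 0)"
  proof (cases "l = 0")
    case False
    have "((\<lambda>e. ln (l + e)) \<longlongrightarrow> ln (l + 0)) (at_right 0)"
      using False by (intro tendsto_intros) auto
    thus ?thesis by (intro tendsto_mult_right) simp
  qed (simp add: w)
qed

text \<open>The kernel contributes its positive weight times \<open>ln e\<close>, while all other
  terms converge.\<close>

lemma trace_log_shift_at_bot:
  assumes X: "psd X" and w: "spec_weight \<rho> X 0 \<noteq> 0" and \<rho>: "psd \<rho>"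
  shows "filterlim (\<lambda>e. trace_log \<rho> (X + e *\<^sub>R mat 1)) at_bot (at_right 0)"
proof -
  let ?c = "spec_weight \<rho> X"
  let ?E = "eigenvals X - {0}"
  have c: "0 < ?c 0" using spec_weight_nonneg[OF \<rho>, of X 0] w by simp
  have 0: "0 \<in> eigenvals X"
    using w spec_weight_not_eigenval by blast
  have split: "trace_log \<rho> (X + e *\<^sub>R mat 1) = ln e * ?c 0 + (\<Sum>l\<in>?E. ln (l + e) * ?c l)" for e
    unfolding trace_log_shift[OF psd_hermitian[OF X]]
    by (subst sum.remove[OF finite_eigenvals[OF psd_hermitian[OF X]] 0]) simp
  have "((\<lambda>e. \<Sum>l\<in>?E. ln (l + e) * ?c l) \<longlongrightarrow> (\<Sum>l\<in>?E. ln (l + 0) * ?c l)) (at_right 0)"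
    by (intro tendsto_sum tendsto_intros) auto
  moreover have "filterlim (\<lambda>e. ln e * ?c 0) at_bot (at_right 0)"
    using filterlim_tendsto_pos_mult_at_bot[OF tendsto_const c ln_at_0] by (simp add: mult.commute)
  ultimately show ?thesis unfolding split
    by (subst add.commute) (subst filterlim_tendsto_add_at_bot_iff)
qed

text \<open>The case where exactly one of \<^term>\<open>a0\<close>, \<^term>\<open>a1\<close> vanishes needs operator monotonicity of the
  logarithm as well as its concavity; this is why \<open>log_jensen\<close> only assumes
  \<^term>\<open>X\<close> to dominate the mixture.\<close>

lemma trace_log_perspective_concave:
  fixes X0 X1 :: "complex^'n^'n"
  assumes \<rho>: "density_op \<rho>" and X: "posdef X0" "posdef X1"
    and a: "0 \<le> a0" "0 \<le> a1" and t: "0 \<le> s" "0 \<le> t" "s + t = 1"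
  shows "s * (a0 * trace_log \<rho> X0 - a0 * ln a0) + t * (a1 * trace_log \<rho> X1 - a1 * ln a1) \<le>
    (s * a0 + t * a1) * trace_log \<rho> (s *\<^sub>R X0 + t *\<^sub>R X1) - (s * a0 + t * a1) * ln (s * a0 + t * a1)"
proof -
  define b where "b = s * a0 + t * a1"
  let ?X = "s *\<^sub>R X0 + t *\<^sub>R X1"
  have b0: "0 \<le> s * a0" "0 \<le> t * a1" using a t by auto
  show ?thesis
  proof (cases "b = 0")
    case True
    hence "s * a0 = 0" "t * a1 = 0" using b0 unfolding b_def by linarith+
    thus ?thesis by (auto simp: algebra_simps)
  next
    case False
    hence b: "0 < b" using b0 by (simp add: b_def)
    \<comment> \<open>Rescaling \<open>X0\<close> by b / a0 compensates the weight s * a0 / b, so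
      that the product is s. The value 1 for \<open>a0 = 0\<close> merely keeps the operator
      positive definite, as its weight is then 0.\<close>
    define c0 where "c0 = (if a0 = 0 then 1 else b / a0)"
    define c1 where "c1 = (if a1 = 0 then 1 else b / a1)"
    have c: "0 < c0" "0 < c1" using a b by (auto simp: c0_def c1_def)
    have posX: "posdef ?X"
    proof (cases "t = 0")
      case True
      thus ?thesis using X t by simp
    next
      case False
      thus ?thesis using X t by (intro posdef_psd_add psd_scaleR posdef_scaleR posdef_psd) auto
    qed
    have tr: "Re (trace \<rho>) = 1" using \<rho> by (simp add: density_op_def)
    have scale: "trace_log \<rho> (c *\<^sub>R Y) = ln c + trace_log \<rho> Y" if "posdef Y" "0 < c" for c Y
      using that by (intro trace_log_scale_pos posdef_psd spec_weight_posdef tr)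
    have "(s * a0 / b) * trace_log \<rho> (c0 *\<^sub>R X0) + (t * a1 / b) * trace_log \<rho> (c1 *\<^sub>R X1)
        \<le> trace_log \<rho> ?X"
    proof (rule trace_log_superconcave[OF \<rho>])
      \<comment> \<open>A summand with vanishing \<open>a0\<close> or \<open>a1\<close> is absent
        from the mixture but present in \<open>?X\<close>; this surplus is where monotonicity is
        used.\<close>
      have "?X - ((s * a0 / b) *\<^sub>R c0 *\<^sub>R X0 + (t * a1 / b) *\<^sub>R c1 *\<^sub>R X1) =
          (if a0 = 0 then s else 0) *\<^sub>R X0 + (if a1 = 0 then t else 0) *\<^sub>R X1"
        using b by (simp add: c0_def c1_def)
      also have "psd \<dots>" using X t by (intro psd_add psd_scaleR posdef_psd) auto
      finally show "psd (?X - ((s * a0 / b) *\<^sub>R c0 *\<^sub>R X0 + (t * a1 / b) *\<^sub>R c1 *\<^sub>R X1))" .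
      show "s * a0 / b + t * a1 / b = 1" using b by (simp add: b_def flip: add_divide_distrib)
    qed (use X posX c b b0 in \<open>auto intro: posdef_scaleR\<close>)
    hence "b * ((s * a0 / b) * (ln c0 + trace_log \<rho> X0) + (t * a1 / b) * (ln c1 + trace_log \<rho> X1))
        \<le> b * trace_log \<rho> ?X"
      using b c X by (intro mult_left_mono) (simp_all add: scale)
    moreover have "b * ((s * a0 / b) * x + (t * a1 / b) * y) = s * (a0 * x) + t * (a1 * y)" for x y
      using b by (simp add: distrib_left)
    ultimately have le: "s * (a0 * (ln c0 + trace_log \<rho> X0)) + t * (a1 * (ln c1 + trace_log \<rho> X1))
        \<le> b * trace_log \<rho> ?X"
      by (simp only:)
    \<comment> \<open>For \<open>a0 = 0\<close> both sides are 0, whatever the default value of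
      \<open>c0\<close>.\<close>
    have split0: "a0 * (ln c0 + trace_log \<rho> X0) = (a0 * trace_log \<rho> X0 - a0 * ln a0) + a0 * ln b"
      using b a by (simp add: c0_def ln_div algebra_simps)
    have split1: "a1 * (ln c1 + trace_log \<rho> X1) = (a1 * trace_log \<rho> X1 - a1 * ln a1) + a1 * ln b"
      using b a by (simp add: c1_def ln_div algebra_simps)
    have "b * ln b = s * (a0 * ln b) + t * (a1 * ln b)" by (simp add: b_def algebra_simps)
    with le[unfolded split0 split1] show ?thesis
      unfolding b_def[symmetric] distrib_left by linarith
  qed
qed

lemma continuous_on_x_ln_x: "continuous_on {0..} (\<lambda>x::real. x * ln x)"
  unfolding continuous_on_def
proof
  fix x :: real assume "x \<in> {0..}"
  show "((\<lambda>x. x * ln x) \<longlongrightarrow> x * ln x) (at x within {0..})"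
  proof (cases "x = 0")
    case True
    have "((\<lambda>x::real. x * ln x) \<longlongrightarrow> 0) (at_right 0)" by real_asymp
    thus ?thesis using True by (simp add: at_within_Ici_at_right)
  next
    case False
    thus ?thesis by (intro tendsto_intros) auto
  qed
qed

section \<open>Upper-semicontinuous closure of the objective\<close>

text \<open>The objective with both operators shifted by \<^term>\<open>e > (0::real)\<close>.  It is finite and continuous
  on the whole closed domain and decreases to \<^const>\<open>Phi\<close> as \<^term>\<open>e\<close> tends to zero.\<close>

definition Phi_shift ::
  "complex^'n^'n \<Rightarrow> complex^'n^'n \<Rightarrow> real \<Rightarrow> real \<Rightarrow> complex^'n^'n \<Rightarrow> real" where
  "Phi_shift \<rho>0 \<rho>1 e a R =
     (a * trace_log \<rho>0 (R + e *\<^sub>R mat 1) - a * ln a) +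
     ((1 - a) * trace_log \<rho>1 (mat 1 - R + e *\<^sub>R mat 1) - (1 - a) * ln (1 - a))"

text \<open>An infimum of continuous concave functions is upper semicontinuous and concave, which
  the \<open>Limsup\<close> in \<open>Phi\<close> does not show directly.\<close>

definition Phi_inf :: "complex^'n^'n \<Rightarrow> complex^'n^'n \<Rightarrow> real \<Rightarrow> complex^'n^'n \<Rightarrow> ereal" where
  "Phi_inf \<rho>0 \<rho>1 a R = (INF e\<in>{0<..}. ereal (Phi_shift \<rho>0 \<rho>1 e a R))"

lemma Phi_inf_le: "0 < e \<Longrightarrow> Phi_inf \<rho>0 \<rho>1 a R \<le> ereal (Phi_shift \<rho>0 \<rho>1 e a R)"
  unfolding Phi_inf_def by (rule INF_lower) simp

lemma posdef_shift: "psd X \<Longrightarrow> 0 < e \<Longrightarrow> posdef (X + e *\<^sub>R mat 1 :: complex^'n^'n)"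
  by (intro posdef_psd_add posdef_scaleR posdef_one)

lemma convex_effects: "convex (effects :: (complex^'n^'n) set)"
  unfolding convex_def
proof (intro ballI allI impI)
  fix X Y :: "complex^'n^'n" and u v :: real
  assume *: "X \<in> effects" "Y \<in> effects" "0 \<le> u" "0 \<le> v" "u + v = 1"
  have "mat 1 - (u *\<^sub>R X + v *\<^sub>R Y) = (u + v) *\<^sub>R mat 1 - (u *\<^sub>R X + v *\<^sub>R Y)"
    using * by simp
  also have "\<dots> = u *\<^sub>R (mat 1 - X) + v *\<^sub>R (mat 1 - Y)"
    by (simp only: scaleR_add_left scaleR_diff_right) simp
  finally show "u *\<^sub>R X + v *\<^sub>R Y \<in> effects"
    using * by (simp add: effects_def psd_add psd_scaleR)
qed

text \<open>Both brackets are perspectives, evaluated at a and R + e and at 1 - a and 1 - R + e, all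
  of which are affine in the pair (a, R).\<close>

lemma Phi_shift_concave:
  fixes \<rho>0 \<rho>1 R S :: "complex^'n^'n"
  assumes \<rho>: "density_op \<rho>0" "density_op \<rho>1" and e: "0 < e"
    and a: "a \<in> {0..1}" "b \<in> {0..1}" and R: "R \<in> effects" "S \<in> effects"
    and t: "0 \<le> t" "t \<le> 1"
  shows "(1 - t) * Phi_shift \<rho>0 \<rho>1 e a R + t * Phi_shift \<rho>0 \<rho>1 e b S \<le>
    Phi_shift \<rho>0 \<rho>1 e ((1 - t) * a + t * b) ((1 - t) *\<^sub>R R + t *\<^sub>R S)"
proof -
  have eqs: "(1 - t) *\<^sub>R (R + e *\<^sub>R mat 1) + t *\<^sub>R (S + e *\<^sub>R mat 1) =
       (1 - t) *\<^sub>R R + t *\<^sub>R S + e *\<^sub>R mat 1"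
    "(1 - t) *\<^sub>R (mat 1 - R + e *\<^sub>R mat 1) + t *\<^sub>R (mat 1 - S + e *\<^sub>R mat 1) =
       mat 1 - ((1 - t) *\<^sub>R R + t *\<^sub>R S) + e *\<^sub>R mat 1"
    "(1 - t) * (1 - a) + t * (1 - b) = 1 - ((1 - t) * a + t * b)"
    by (simp_all add: algebra_simps)
  note c0 = trace_log_perspective_concave[OF \<rho>(1), of "R + e *\<^sub>R mat 1" "S + e *\<^sub>R mat 1" a b "1 - t" t,
      unfolded eqs]
  note c1 = trace_log_perspective_concave[OF \<rho>(2), of "mat 1 - R + e *\<^sub>R mat 1"
      "mat 1 - S + e *\<^sub>R mat 1" "1 - a" "1 - b" "1 - t" t, unfolded eqs]
  have "posdef (R + e *\<^sub>R mat 1)" "posdef (S + e *\<^sub>R mat 1)"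
    "posdef (mat 1 - R + e *\<^sub>R mat 1)" "posdef (mat 1 - S + e *\<^sub>R mat 1)"
    using R e by (auto intro!: posdef_shift effects_psd)
  thus ?thesis unfolding Phi_shift_def using c0 c1 a t by (simp add: distrib_left)
qed

lemma Phi_shift_continuous:
  fixes \<rho>0 \<rho>1 :: "complex^'n^'n"
  assumes \<rho>: "density_op \<rho>0" "density_op \<rho>1" and e: "0 < e"
  shows "continuous_on ({0..1} \<times> effects) (\<lambda>x. Phi_shift \<rho>0 \<rho>1 e (fst x) (snd x))"
proof -
  let ?D = "{0..1::real} \<times> (effects :: (complex^'n^'n) set)"
  have log: "continuous_on ?D (\<lambda>x. trace_log \<rho> (g x))"
    if "density_op \<rho>" "continuous_on ?D g" "\<And>x. x \<in> ?D \<Longrightarrow> posdef (g x)"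
    for \<rho> :: "complex^'n^'n" and g :: "real \<times> (complex^'n^'n) \<Rightarrow> complex^'n^'n"
    by (rule continuous_on_compose2[OF continuous_on_trace_log]) (use that in auto)
  have xlnx: "continuous_on ?D (\<lambda>x. g x * ln (g x))"
    if "continuous_on ?D g" "\<And>x. x \<in> ?D \<Longrightarrow> 0 \<le> g x"
    for g :: "real \<times> (complex^'n^'n) \<Rightarrow> real"
    by (rule continuous_on_compose2[OF continuous_on_x_ln_x]) (use that in auto)
  have "continuous_on ?D (\<lambda>x. trace_log \<rho>0 (snd x + e *\<^sub>R mat 1))"
    by (rule log[OF \<rho>(1)]) (auto intro!: continuous_intros posdef_shift effects_psd e)
  moreover have "continuous_on ?D (\<lambda>x. trace_log \<rho>1 (mat 1 - snd x + e *\<^sub>R mat 1))"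
    by (rule log[OF \<rho>(2)]) (auto intro!: continuous_intros posdef_shift effects_psd e)
  moreover have "continuous_on ?D (\<lambda>x. fst x * ln (fst x))"
    by (rule xlnx) (auto intro!: continuous_intros)
  moreover have "continuous_on ?D (\<lambda>x. (1 - fst x) * ln (1 - fst x))"
    by (rule xlnx) (auto intro!: continuous_intros)
  moreover have "continuous_on ?D fst" "continuous_on ?D (\<lambda>x. 1 - fst x)"
    by (auto intro!: continuous_intros)
  ultimately show ?thesis unfolding Phi_shift_def
    by (intro continuous_on_add continuous_on_diff) (assumption | rule continuous_on_mult)+
qed

text \<open>The shifted operators have eigenvalues at most 1 + e; what remains is the binary entropy
  of a. This bound later makes the set of mutual informations bounded.\<close>

lemma Phi_shift_le:
  assumes \<rho>: "density_op \<rho>0" "density_op \<rho>1" and e: "0 < e"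
    and a: "0 < a" "a < 1" and R: "R \<in> effects"
  shows "Phi_shift \<rho>0 \<rho>1 e a R \<le> ln (1 + e) - a * ln a - (1 - a) * ln (1 - a)"
proof -
  have "a * trace_log \<rho>0 (R + e *\<^sub>R mat 1) \<le> a * ln (1 + e)"
    using a by (intro mult_left_mono trace_log_shift_le R \<rho> e) auto
  moreover have "(1 - a) * trace_log \<rho>1 (mat 1 - R + e *\<^sub>R mat 1) \<le> (1 - a) * ln (1 + e)"
    using a by (intro mult_left_mono trace_log_shift_le complement_effects R \<rho> e) auto
  ultimately show ?thesis by (simp add: Phi_shift_def algebra_simps)
qed

lemma Phi_shift_mono:
  assumes \<rho>: "density_op \<rho>0" "density_op \<rho>1" and e: "0 < e" "e \<le> e'"
    and a: "0 \<le> a" "a \<le> 1" and R: "R \<in> effects"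
  shows "Phi_shift \<rho>0 \<rho>1 e a R \<le> Phi_shift \<rho>0 \<rho>1 e' a R"
  unfolding Phi_shift_def using \<rho> a
  by (intro add_mono diff_right_mono mult_left_mono trace_log_shift_mono effects_psd[OF R] e)
     (auto simp: density_op_def)

lemma Phi_formula_supp:
  assumes \<rho>: "density_op \<rho>0" "density_op \<rho>1"
    and a: "0 < a" "a < 1" and R: "R \<in> effects"
    and w: "spec_weight \<rho>0 R 0 = 0" "spec_weight \<rho>1 (mat 1 - R) 0 = 0"
  shows "Phi_formula \<rho>0 \<rho>1 a R =
    (a * trace_log \<rho>0 R - a * ln a) + ((1 - a) * trace_log \<rho>1 (mat 1 - R) - (1 - a) * ln (1 - a))"
proof -
  have h0: "trace_log \<rho>0 ((1 / a) *\<^sub>R R) = ln (1 / a) + trace_log \<rho>0 R"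
    using a \<rho> by (intro trace_log_scale_pos effects_psd R w) (auto simp: density_op_def)
  have h1: "trace_log \<rho>1 ((1 / (1 - a)) *\<^sub>R (mat 1 - R)) = ln (1 / (1 - a)) + trace_log \<rho>1 (mat 1 - R)"
    using a \<rho> by (intro trace_log_scale_pos effects_psd R w) (auto simp: density_op_def)
  show ?thesis unfolding Phi_formula_def trace_log_def[symmetric] h0 h1 using a
    by (simp add: ln_div algebra_simps)
qed

text \<open>If both kernel weights vanish, the shifted values decrease to the formula. Otherwise one
  logarithm diverges to minus infinity while the other stays bounded above.\<close>

lemma Phi_inf_eq:
  fixes \<rho>0 \<rho>1 R :: "complex^'n^'n"
  assumes \<rho>: "density_op \<rho>0" "density_op \<rho>1"
    and a: "0 < a" "a < 1" and R: "R \<in> effects"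
  shows "Phi_inf \<rho>0 \<rho>1 a R =
    (if supp \<rho>0 \<subseteq> supp R \<and> supp \<rho>1 \<subseteq> supp (mat 1 - R) then ereal (Phi_formula \<rho>0 \<rho>1 a R) else - \<infinity>)"
proof -
  note psd = effects_psd[OF R]
  have \<rho>psd: "psd \<rho>0" "psd \<rho>1" using \<rho> by (auto simp: density_op_def)
  show ?thesis
  proof (cases "supp \<rho>0 \<subseteq> supp R \<and> supp \<rho>1 \<subseteq> supp (mat 1 - R)")
    case True
    hence w: "spec_weight \<rho>0 R 0 = 0" "spec_weight \<rho>1 (mat 1 - R) 0 = 0"
      using \<rho>psd by (auto simp: supp_subset_iff)
    have "Phi_formula \<rho>0 \<rho>1 a R \<le> Phi_shift \<rho>0 \<rho>1 e a R" if "0 < e" for e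
      unfolding Phi_formula_supp[OF \<rho> a R w] Phi_shift_def using a
      by (intro add_mono diff_right_mono mult_left_mono trace_log_shift_ge psd w \<rho>psd that) auto
    hence "ereal (Phi_formula \<rho>0 \<rho>1 a R) \<le> Phi_inf \<rho>0 \<rho>1 a R"
      unfolding Phi_inf_def by (intro INF_greatest) auto
    moreover have "((\<lambda>e. Phi_shift \<rho>0 \<rho>1 e a R) \<longlongrightarrow> Phi_formula \<rho>0 \<rho>1 a R) (at_right 0)"
      unfolding Phi_formula_supp[OF \<rho> a R w] Phi_shift_def
      by (intro tendsto_intros trace_log_shift_tendsto psd w)
    hence "((\<lambda>e. ereal (Phi_shift \<rho>0 \<rho>1 e a R)) \<longlongrightarrow> ereal (Phi_formula \<rho>0 \<rho>1 a R)) (at_right 0)"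
      by (rule tendsto_ereal)
    hence "Phi_inf \<rho>0 \<rho>1 a R \<le> ereal (Phi_formula \<rho>0 \<rho>1 a R)"
      by (rule tendsto_lowerbound) (auto intro: eventually_mono[OF eventually_at_right_less] Phi_inf_le)
    ultimately show ?thesis using True by simp
  next
    case False
    \<comment> \<open>For e < 1 the shifted eigenvalues stay below 2, hence the constant
      \<open>ln 2\<close>.\<close>
    have bd: "\<forall>\<^sub>F e in at_right 0. trace_log \<rho> (X + e *\<^sub>R mat 1) \<le> ln 2"
      if "density_op \<rho>" "X \<in> effects" for \<rho> X :: "complex^'n^'n"
    proof -
      have "\<forall>\<^sub>F e in at_right 0. e < (1::real)" by (rule eventually_at_right_real[of 0 1, THEN eventually_mono]) auto
      moreover have "\<forall>\<^sub>F e in at_right 0. 0 < (e::real)" by (rule eventually_at_right_less)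
      ultimately show ?thesis
      proof eventually_elim
        case (elim e)
        thus ?case using trace_log_shift_le[OF that(2,1), of e]
          by (smt (verit) ln_le_cancel_iff)
      qed
    qed
    have lim: "\<forall>\<^sub>F e in at_right 0. a' * f e + (1 - a') * g e + k \<le> B"
      if f: "filterlim f at_bot (at_right 0)" and g: "\<forall>\<^sub>F e in at_right 0. g e \<le> ln 2"
        and a': "0 < a'" "a' < 1" for a' k B :: real and f g
    proof -
      have "\<forall>\<^sub>F e in at_right 0. f e \<le> (B - k - (1 - a') * ln 2) / a'"
        using f by (simp add: filterlim_at_bot)
      with g show ?thesis
      proof eventually_elim
        case (elim e)
        have "a' * f e \<le> B - k - (1 - a') * ln 2" using elim(2) a' by (simp add: field_simps)
        moreover have "(1 - a') * g e \<le> (1 - a') * ln 2" using elim(1) a' by (intro mult_left_mono) auto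
        ultimately show ?case by simp
      qed
    qed
    have ev: "\<forall>\<^sub>F e in at_right 0. Phi_shift \<rho>0 \<rho>1 e a R \<le> B" for B
    proof (cases "spec_weight \<rho>0 R 0 = 0")
      case True
      hence "spec_weight \<rho>1 (mat 1 - R) 0 \<noteq> 0" using False \<rho>psd by (auto simp: supp_subset_iff)
      from lim[OF trace_log_shift_at_bot[OF psd(2) this \<rho>psd(2)] bd[OF \<rho>(1) R], of "1 - a" "- a * ln a - (1 - a) * ln (1 - a)" B]
      show ?thesis using a by (simp add: Phi_shift_def algebra_simps)
    next
      case False
      from lim[OF trace_log_shift_at_bot[OF psd(1) this \<rho>psd(1)] bd[OF \<rho>(2) complement_effects[OF R]], of a "- a * ln a - (1 - a) * ln (1 - a)" B]
      show ?thesis using a by (simp add: Phi_shift_def algebra_simps)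
    qed
    have "Phi_inf \<rho>0 \<rho>1 a R \<le> ereal B" for B
    proof -
      from eventually_conj[OF ev[of B] eventually_at_right_less]
      obtain e where "Phi_shift \<rho>0 \<rho>1 e a R \<le> B" "0 < e"
        using eventually_happens[of _ "at_right (0::real)"] by auto
      thus ?thesis using Phi_inf_le[of e \<rho>0 \<rho>1 a R] by (metis ereal_less_eq(3) order_trans)
    qed
    thus ?thesis unfolding if_not_P[OF False] by (rule ereal_bot)
  qed
qed

text \<open>For each e the two infima on the left are bounded by their values at this same e, where
  concavity is already known.\<close>

lemma Phi_inf_concave:
  fixes \<rho>0 \<rho>1 R S :: "complex^'n^'n"
  assumes \<rho>: "density_op \<rho>0" "density_op \<rho>1"
    and a: "a \<in> {0..1}" "b \<in> {0..1}" and R: "R \<in> effects" "S \<in> effects"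
    and t: "0 < t" "t < 1"
  shows "ereal (1 - t) * Phi_inf \<rho>0 \<rho>1 a R + ereal t * Phi_inf \<rho>0 \<rho>1 b S \<le>
    Phi_inf \<rho>0 \<rho>1 ((1 - t) * a + t * b) ((1 - t) *\<^sub>R R + t *\<^sub>R S)"
  unfolding Phi_inf_def[of _ _ "(1 - t) * a + t * b"]
proof (rule INF_greatest)
  fix e :: real assume "e \<in> {0<..}"
  hence e: "0 < e" by simp
  have "ereal (1 - t) * Phi_inf \<rho>0 \<rho>1 a R + ereal t * Phi_inf \<rho>0 \<rho>1 b S \<le>
      ereal (1 - t) * ereal (Phi_shift \<rho>0 \<rho>1 e a R) + ereal t * ereal (Phi_shift \<rho>0 \<rho>1 e b S)"
    using t e by (intro add_mono ereal_mult_left_mono Phi_inf_le) auto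
  also have "\<dots> \<le> ereal (Phi_shift \<rho>0 \<rho>1 e ((1 - t) * a + t * b) ((1 - t) *\<^sub>R R + t *\<^sub>R S))"
    using Phi_shift_concave[OF \<rho> e a R, of t] t by simp
  finally show "ereal (1 - t) * Phi_inf \<rho>0 \<rho>1 a R + ereal t * Phi_inf \<rho>0 \<rho>1 b S \<le>
      ereal (Phi_shift \<rho>0 \<rho>1 e ((1 - t) * a + t * b) ((1 - t) *\<^sub>R R + t *\<^sub>R S))" .
qed

lemma strict_effects_subset: "strict_effects \<subseteq> (effects :: (complex^'n^'n) set)"
  by (auto simp: strict_effects_def effects_def posdef_psd)

lemma Phi_inf_strict:
  assumes \<rho>: "density_op \<rho>0" "density_op \<rho>1" and x: "(a, R) \<in> {0<..<1} \<times> strict_effects"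
  shows "Phi_inf \<rho>0 \<rho>1 a R = ereal (Phi_formula \<rho>0 \<rho>1 a R)"
proof -
  have "R \<in> effects" "posdef R" "posdef (mat 1 - R)"
    using x strict_effects_subset by (auto simp: strict_effects_def)
  thus ?thesis using x Phi_inf_eq[OF \<rho>, of a R] \<rho>
    by (simp add: supp_subset_iff density_op_def spec_weight_posdef)
qed

text \<open>This lets the values along a single segment bound the \<open>Limsup\<close> in
  \<open>Phi\<close> from below.\<close>

lemma Limsup_filterlim_le:
  fixes f :: "'a \<Rightarrow> ereal"
  assumes "filterlim z F H"
  shows "Limsup H (\<lambda>t. f (z t)) \<le> Limsup F f"
  unfolding Limsup_def
proof (rule INF_mono)
  fix P assume "P \<in> {P. eventually P F}"
  hence "eventually (\<lambda>t. P (z t)) H" using assms by (simp add: filterlim_iff)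
  moreover have "(SUP t\<in>{t. P (z t)}. f (z t)) \<le> Sup (f ` Collect P)"
    by (rule SUP_least) (auto intro: SUP_upper)
  ultimately show "\<exists>Q\<in>{Q. eventually Q H}. (SUP t\<in>Collect Q. f (z t)) \<le> (SUP x\<in>Collect P. f x)"
    by blast
qed

text \<open>For the lower bound, approach \<^term>\<open>(a, R)\<close> along the segment from the centre of the domain:
  by concavity the values there are at least those of the chord.\<close>

lemma Phi_eq_Phi_inf:
  fixes \<rho>0 \<rho>1 R :: "complex^'n^'n"
  assumes \<rho>: "density_op \<rho>0" "density_op \<rho>1" and a: "a \<in> {0..1}" and R: "R \<in> effects"
  shows "Phi \<rho>0 \<rho>1 a R = Phi_inf \<rho>0 \<rho>1 a R"
proof (cases "(a, R) \<in> {0<..<1} \<times> strict_effects")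
  case True
  thus ?thesis using Phi_inf_strict[OF \<rho> True] by (simp add: Phi_def)
next
  case False
  define C :: "(real \<times> (complex^'n^'n)) set" where "C = {0<..<1} \<times> strict_effects"
  define f where "f = (\<lambda>x :: real \<times> (complex^'n^'n). ereal (Phi_formula \<rho>0 \<rho>1 (fst x) (snd x)))"
  have f: "f x = Phi_inf \<rho>0 \<rho>1 (fst x) (snd x)" if "x \<in> C" for x
    using Phi_inf_strict[OF \<rho>, of "fst x" "snd x"] that by (simp add: f_def C_def)
  have CD: "C \<subseteq> {0..1} \<times> effects" using strict_effects_subset by (auto simp: C_def)
  \<comment> \<open>The filter in \<open>Phi\<close> excludes its base point; outside
    \<open>C\<close> that costs nothing, since the segment runs inside \<open>C\<close>.\<close>
  have xC: "(a, R) \<notin> C" using False by (simp add: C_def)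
  have Phi: "Phi \<rho>0 \<rho>1 a R = Limsup (at (a, R) within C) f"
    unfolding Phi_def C_def f_def by (subst if_not_P[OF False]) (simp add: case_prod_unfold)
  define z where "z t = ((1 - t) * a + t * (1/2), (1 - t) *\<^sub>R R + t *\<^sub>R ((1/2) *\<^sub>R mat 1 :: complex^'n^'n))"
    for t :: real
  have zC: "z t \<in> C" if t: "0 < t" "t < 1" for t
  proof -
    have "0 < (1 - t) * a + t * (1/2)" using t a by (intro add_nonneg_pos) auto
    moreover have "(1 - t) * a \<le> (1 - t) * 1" using t a by (intro mult_left_mono) auto
    moreover have "x + t * (1/2) < 1" if "x \<le> (1 - t) * 1" for x using that t by simp
    ultimately have "(1 - t) * a + t * (1/2) < 1" "0 < (1 - t) * a + t * (1/2)" by blast+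
    moreover have "posdef ((1 - t) *\<^sub>R R + t *\<^sub>R ((1/2) *\<^sub>R mat 1))"
      using t R by (intro posdef_psd_add psd_scaleR posdef_scaleR posdef_one effects_psd) auto
    moreover have "posdef (mat 1 - ((1 - t) *\<^sub>R R + t *\<^sub>R ((1/2) *\<^sub>R mat 1)))"
    proof -
      have "(t / 2) *\<^sub>R mat 1 + (t / 2) *\<^sub>R mat 1 = t *\<^sub>R (mat 1 :: complex^'n^'n)"
        by (simp flip: scaleR_add_left)
      hence "mat 1 - ((1 - t) *\<^sub>R R + t *\<^sub>R ((1/2) *\<^sub>R mat 1)) =
          (1 - t) *\<^sub>R (mat 1 - R) + t *\<^sub>R ((1/2) *\<^sub>R mat 1)"
        by (simp add: algebra_simps)
      also have "posdef \<dots>"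
        using t R by (intro posdef_psd_add psd_scaleR posdef_scaleR posdef_one effects_psd) auto
      finally show ?thesis .
    qed
    ultimately show ?thesis by (simp add: z_def C_def strict_effects_def)
  qed
  have t01: "\<forall>\<^sub>F t in at_right 0. 0 < t \<and> t < (1::real)"
    using eventually_at_right_real[of 0 1] by simp
  have "(z \<longlongrightarrow> (a, R)) (at_right 0)"
  proof -
    have "(z \<longlongrightarrow> ((1 - 0) * a + 0 * (1/2), (1 - 0) *\<^sub>R R + 0 *\<^sub>R ((1/2) *\<^sub>R mat 1))) (at_right 0)"
      unfolding z_def by (intro tendsto_intros)
    thus ?thesis by simp
  qed
  moreover have "\<forall>\<^sub>F t in at_right 0. z t \<in> C \<and> z t \<noteq> (a, R)"
    by (rule eventually_mono[OF t01]) (use zC xC in metis)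
  ultimately have zlim: "filterlim z (at (a, R) within C) (at_right 0)"
    unfolding filterlim_at by blast
  have "Phi_inf \<rho>0 \<rho>1 a R \<le> Limsup (at (a, R) within C) f"
  proof (cases "Phi_inf \<rho>0 \<rho>1 a R = - \<infinity>")
    case False
    have half: "z 1 \<in> C"
    proof -
      have "mat 1 - (1/2) *\<^sub>R mat 1 = ((1/2) *\<^sub>R mat 1 :: complex^'n^'n)"
        by (simp add: vec_eq_iff mat_def)
      moreover have "posdef ((1/2) *\<^sub>R mat 1 :: complex^'n^'n)"
        by (intro posdef_scaleR posdef_one) simp
      ultimately have "posdef (mat 1 - (1/2) *\<^sub>R mat 1 :: complex^'n^'n)" by (simp only:)
      thus ?thesis by (simp add: z_def C_def strict_effects_def posdef_scaleR posdef_one)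
    qed
    obtain r where r: "Phi_inf \<rho>0 \<rho>1 a R = ereal r"
      using False Phi_inf_le[of 1 \<rho>0 \<rho>1 a R] by (cases "Phi_inf \<rho>0 \<rho>1 a R") auto
    define q where "q = Phi_formula \<rho>0 \<rho>1 (fst (z 1)) (snd (z 1))"
    have q: "Phi_inf \<rho>0 \<rho>1 (1/2) ((1/2) *\<^sub>R mat 1) = ereal q"
      using f[OF half] by (simp add: f_def z_def q_def)
    have low: "ereal ((1 - t) * r + t * q) \<le> f (z t)" if t: "0 < t" "t < 1" for t
    proof -
      have "z 1 \<in> {0..1} \<times> effects" using half CD by blast
      hence "(1/2) *\<^sub>R mat 1 \<in> (effects :: (complex^'n^'n) set)" by (simp add: z_def)
      hence "ereal (1 - t) * Phi_inf \<rho>0 \<rho>1 a R + ereal t * Phi_inf \<rho>0 \<rho>1 (1/2) ((1/2) *\<^sub>R mat 1)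
          \<le> Phi_inf \<rho>0 \<rho>1 (fst (z t)) (snd (z t))"
        using Phi_inf_concave[OF \<rho> a _ R _ t, of "1/2" "(1/2) *\<^sub>R mat 1"] by (simp add: z_def)
      thus ?thesis unfolding f[OF zC[OF t]] r q by simp
    qed
    have "((\<lambda>t. (1 - t) * r + t * q) \<longlongrightarrow> (1 - 0) * r + 0 * q) (at_right 0)"
      by (intro tendsto_intros)
    hence "((\<lambda>t. ereal ((1 - t) * r + t * q)) \<longlongrightarrow> ereal r) (at_right 0)"
      using tendsto_ereal by fastforce
    hence "ereal r = Limsup (at_right 0) (\<lambda>t. ereal ((1 - t) * r + t * q))"
      by (intro lim_imp_Limsup[symmetric]) auto
    also have "\<dots> \<le> Limsup (at_right 0) (\<lambda>t. f (z t))"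
      by (rule Limsup_mono) (auto intro: eventually_mono[OF t01] low)
    also have "\<dots> \<le> Limsup (at (a, R) within C) f"
      by (rule Limsup_filterlim_le[OF zlim])
    finally show ?thesis unfolding r .
  qed simp
  moreover have "Limsup (at (a, R) within C) f \<le> Phi_inf \<rho>0 \<rho>1 a R"
    unfolding Phi_inf_def
  proof (rule INF_greatest)
    fix e :: real assume "e \<in> {0<..}"
    hence e: "0 < e" by simp
    \<comment> \<open>Identifying a limit with its \<open>Limsup\<close> requires a nontrivial
      filter; the segment \<open>z\<close> tends into this one, so it is nontrivial.\<close>
    have nt: "at (a, R) within C \<noteq> bot"
    proof
      assume "at (a, R) within C = bot"
      thus False using zlim[unfolded filterlim_iff, rule_format, of "\<lambda>_. False"] by simp
    qed
    have "((\<lambda>x. Phi_shift \<rho>0 \<rho>1 e (fst x) (snd x)) \<longlongrightarrow> Phi_shift \<rho>0 \<rho>1 e a R) (at (a, R) within {0..1} \<times> effects)"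
      using Phi_shift_continuous[OF \<rho> e] a R by (force simp: continuous_on_def)
    hence "((\<lambda>x. ereal (Phi_shift \<rho>0 \<rho>1 e (fst x) (snd x))) \<longlongrightarrow> ereal (Phi_shift \<rho>0 \<rho>1 e a R)) (at (a, R) within C)"
      by (intro tendsto_ereal) (rule tendsto_within_subset[OF _ CD])
    hence "Limsup (at (a, R) within C) (\<lambda>x. ereal (Phi_shift \<rho>0 \<rho>1 e (fst x) (snd x))) = ereal (Phi_shift \<rho>0 \<rho>1 e a R)"
      by (rule lim_imp_Limsup[OF nt])
    moreover have "Limsup (at (a, R) within C) f \<le>
        Limsup (at (a, R) within C) (\<lambda>x. ereal (Phi_shift \<rho>0 \<rho>1 e (fst x) (snd x)))"
      by (rule Limsup_mono) (auto simp: eventually_at_filter f Phi_inf_le[OF e])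
    ultimately show "Limsup (at (a, R) within C) f \<le> ereal (Phi_shift \<rho>0 \<rho>1 e a R)" by simp
  qed
  ultimately show ?thesis unfolding Phi by simp
qed

section \<open>Measurements and accessible information\<close>

text \<open>This is ln x <= x - 1 at x = m l / (a u). Here l acts as a guessed posterior of the
  letter, and m l - a u is the slack.\<close>

lemma gibbs_term:
  fixes a u m l :: real
  assumes "0 < a" "0 \<le> u" "a * u \<le> m" "0 \<le> l" "l = 0 \<Longrightarrow> u = 0"
  shows "a * (ln (l / a) * u) \<le> a * u * ln (u / m) + (m * l - a * u)"
proof (cases "u = 0")
  case True
  thus ?thesis using assms by simp
next
  case False
  hence u: "0 < u" "0 < l" "0 < a * u" using assms by (auto simp: order_less_le)
  hence m: "0 < m" using assms(3) by linarith
  have "ln (l / a) - ln (u / m) = ln ((l / a) / (u / m))"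
    using u(1,2) m assms(1) by (subst (3) ln_div) auto
  also have "\<dots> = ln (m * l / (a * u))" by (simp add: mult.commute)
  also have "\<dots> \<le> m * l / (a * u) - 1"
    using u(1,2) m assms(1) by (intro ln_le_minus_one) auto
  finally have "a * u * (ln (l / a) - ln (u / m)) \<le> a * u * (m * l / (a * u) - 1)"
    using u by (intro mult_left_mono) auto
  also have "\<dots> = m * l - a * u" using u assms(1) by (simp add: right_diff_distrib)
  finally show ?thesis by (simp add: algebra_simps)
qed

text \<open>The guesses l and 1 - l for the two letters have slacks that cancel, because m is the
  total probability of the outcome.\<close>

lemma mutual_info_term_ge:
  fixes a u v l :: real
  assumes a: "0 < a" "a < 1" and uv: "0 \<le> u" "0 \<le> v" and l: "0 \<le> l" "l \<le> 1"
    and supp: "l = 0 \<Longrightarrow> u = 0" "l = 1 \<Longrightarrow> v = 0"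
  shows "a * (ln (l / a) * u) + (1 - a) * (ln ((1 - l) / (1 - a)) * v) \<le>
    a * u * ln (u / (a * u + (1 - a) * v)) + (1 - a) * v * ln (v / (a * u + (1 - a) * v))"
proof -
  define m where "m = a * u + (1 - a) * v"
  have nn: "0 \<le> a * u" "0 \<le> (1 - a) * v" using a uv by auto
  have "a * (ln (l / a) * u) \<le> a * u * ln (u / m) + (m * l - a * u)"
    by (rule gibbs_term) (use a uv l supp nn in \<open>auto simp: m_def\<close>)
  moreover have "(1 - a) * (ln ((1 - l) / (1 - a)) * v) \<le> (1 - a) * v * ln (v / m) + (m * (1 - l) - (1 - a) * v)"
    by (rule gibbs_term) (use a uv l supp nn in \<open>auto simp: m_def\<close>)
  moreover have "(m * l - a * u) + (m * (1 - l) - (1 - a) * v) = 0" by (simp add: m_def algebra_simps)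
  ultimately show ?thesis unfolding m_def[symmetric] by linarith
qed

lemma trace_povm_nonneg:
  "density_op \<rho> \<Longrightarrow> povm Y M \<Longrightarrow> y \<in> Y \<Longrightarrow> 0 \<le> Re (trace (\<rho> ** M y))"
  by (auto simp: density_op_def povm_def intro: trace_mult_nonneg)

lemma sum_trace_povm:
  "density_op \<rho> \<Longrightarrow> povm Y M \<Longrightarrow> (\<Sum>y\<in>Y. Re (trace (\<rho> ** M y))) = 1"
  by (subst trace_mult_sum_one) (auto simp: density_op_def povm_def)

lemma povm_mixture_effects:
  fixes M :: "nat \<Rightarrow> complex^'n^'n"
  assumes M: "povm Y M" and p: "\<And>y. 0 \<le> p y" "\<And>y. p y \<le> (1::real)"
  shows "(\<Sum>y\<in>Y. p y *\<^sub>R M y) \<in> effects"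
    and "mat 1 - (\<Sum>y\<in>Y. p y *\<^sub>R M y) = (\<Sum>y\<in>Y. (1 - p y) *\<^sub>R M y)"
proof -
  show eq: "mat 1 - (\<Sum>y\<in>Y. p y *\<^sub>R M y) = (\<Sum>y\<in>Y. (1 - p y) *\<^sub>R M y)"
    using M by (simp add: povm_def scaleR_diff_left sum_subtractf)
  show "(\<Sum>y\<in>Y. p y *\<^sub>R M y) \<in> effects"
    unfolding effects_def mem_Collect_eq eq
    using M p by (auto simp: povm_def intro!: psd_sum psd_scaleR)
qed

text \<open>As the POVM sums to the identity, the shift of the operator is a shift of the weights.
  They become positive, as \<open>log_jensen\<close> demands, even where
  \<open>p y = 0\<close>.\<close>

lemma trace_log_povm_mixture:
  fixes M :: "nat \<Rightarrow> complex^'n^'n"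
  assumes \<rho>: "density_op \<rho>" and M: "povm Y M" and p: "\<And>y. 0 \<le> p y" and e: "0 < (e::real)"
  shows "(\<Sum>y\<in>Y. ln (p y + e) * Re (trace (\<rho> ** M y))) \<le>
    trace_log \<rho> ((\<Sum>y\<in>Y. p y *\<^sub>R M y) + e *\<^sub>R mat 1)"
proof (rule log_jensen)
  have "(\<Sum>y\<in>Y. (p y + e) *\<^sub>R M y) = (\<Sum>y\<in>Y. p y *\<^sub>R M y) + e *\<^sub>R mat 1"
    using M by (simp add: povm_def scaleR_add_left sum.distrib flip: scaleR_sum_right)
  thus "psd ((\<Sum>y\<in>Y. p y *\<^sub>R M y) + e *\<^sub>R mat 1 - (\<Sum>y\<in>Y. (p y + e) *\<^sub>R M y))"
    by (simp add: psd_zero)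
  show "posdef ((\<Sum>y\<in>Y. p y *\<^sub>R M y) + e *\<^sub>R mat 1)"
    using M p e by (intro posdef_shift psd_sum psd_scaleR) (auto simp: povm_def)
qed (use \<rho> M p e in \<open>auto simp: density_op_def povm_def add_nonneg_pos\<close>)

text \<open>The effect built from the posterior probabilities \<^term>\<open>a * u y / m y\<close> of the first letter;
  outcomes of probability zero get posterior \<^term>\<open>0::real\<close> through division by zero.\<close>

lemma mutual_info_le_Phi_shift:
  fixes \<rho>0 \<rho>1 :: "complex^'n^'n"
  assumes \<rho>: "density_op \<rho>0" "density_op \<rho>1" and a: "0 < a" "a < 1" and M: "povm Y M"
  shows "\<exists>R\<in>effects. \<forall>e>0. mutual_info \<rho>0 \<rho>1 a Y M \<le> Phi_shift \<rho>0 \<rho>1 e a R"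
proof -
  \<comment> \<open>Cutting off outside \<open>Y\<close> makes the bounds on the posteriors hold for
    all indices, as \<open>povm_mixture_effects\<close> asks.\<close>
  define u where "u y = (if y \<in> Y then Re (trace (\<rho>0 ** M y)) else 0)" for y
  define v where "v y = (if y \<in> Y then Re (trace (\<rho>1 ** M y)) else 0)" for y
  define m where "m y = a * u y + (1 - a) * v y" for y
  define p where "p y = a * u y / m y" for y
  have nn: "0 \<le> u y" "0 \<le> v y" "0 \<le> a * u y" "0 \<le> (1 - a) * v y" for y
    using a \<rho> M by (auto simp: u_def v_def intro!: mult_nonneg_nonneg trace_povm_nonneg)
  have m: "0 \<le> m y" "a * u y \<le> m y" "(1 - a) * v y \<le> m y" for y
    using nn[of y] by (auto simp: m_def)
  have p: "0 \<le> p y" "p y \<le> 1" for y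
    using m[of y] nn[of y] by (auto simp: p_def divide_le_eq_1)
  define R where "R = (\<Sum>y\<in>Y. p y *\<^sub>R M y)"
  have R: "R \<in> effects" "mat 1 - R = (\<Sum>y\<in>Y. (1 - p y) *\<^sub>R M y)"
    unfolding R_def by (rule povm_mixture_effects[OF M p])+
  have "mutual_info \<rho>0 \<rho>1 a Y M \<le> Phi_shift \<rho>0 \<rho>1 e a R" if e: "0 < e" for e
  proof -
    \<comment> \<open>For positive u the posterior satisfies u / m = p / a, so the only loss is in
      replacing ln p by ln (p + e).\<close>
    have t0: "a * u y * ln (u y / m y) \<le> a * (ln (p y + e) * u y) - a * ln a * u y" for y
    proof (cases "u y = 0")
      case False
      hence pos: "0 < u y" "0 < a * u y" using nn(1)[of y] a by auto
      hence mp: "0 < m y" using m(2)[of y] by linarith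
      have q: "u y / m y = p y / a" "0 < p y" using a pos mp by (simp_all add: p_def)
      have "ln (u y / m y) = ln (p y) - ln a" using q a by (simp add: ln_div)
      also have "\<dots> \<le> ln (p y + e) - ln a" using q e by simp
      finally have "a * u y * ln (u y / m y) \<le> a * u y * (ln (p y + e) - ln a)"
        using pos by (intro mult_left_mono) auto
      thus ?thesis by (simp add: algebra_simps)
    qed simp
    have t1: "(1 - a) * v y * ln (v y / m y) \<le> (1 - a) * (ln (1 - p y + e) * v y) - (1 - a) * ln (1 - a) * v y" for y
    proof (cases "v y = 0")
      case False
      hence pos: "0 < v y" "0 < (1 - a) * v y" using nn(2)[of y] a by auto
      hence mp: "0 < m y" using m(3)[of y] by linarith
      have "1 - p y = (1 - a) * v y / m y" using mp by (simp add: p_def m_def field_simps)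
      hence q: "v y / m y = (1 - p y) / (1 - a)" "0 < 1 - p y" using a pos mp by simp_all
      have "ln (v y / m y) = ln (1 - p y) - ln (1 - a)" using q a by (simp add: ln_div)
      also have "\<dots> \<le> ln (1 - p y + e) - ln (1 - a)" using q e by simp
      finally have "(1 - a) * v y * ln (v y / m y) \<le> (1 - a) * v y * (ln (1 - p y + e) - ln (1 - a))"
        using pos by (intro mult_left_mono) auto
      thus ?thesis by (simp add: algebra_simps)
    qed simp
    have sums: "(\<Sum>y\<in>Y. u y) = 1" "(\<Sum>y\<in>Y. v y) = 1"
      using \<rho> M by (simp_all add: u_def v_def sum_trace_povm)
    have "mutual_info \<rho>0 \<rho>1 a Y M =
        (\<Sum>y\<in>Y. a * u y * ln (u y / m y) + (1 - a) * v y * ln (v y / m y))"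
      by (simp add: mutual_info_def Let_def u_def v_def m_def)
    also have "\<dots> \<le> (\<Sum>y\<in>Y. (a * (ln (p y + e) * u y) - a * ln a * u y) +
        ((1 - a) * (ln (1 - p y + e) * v y) - (1 - a) * ln (1 - a) * v y))"
      by (intro sum_mono add_mono t0 t1)
    also have "\<dots> = (a * (\<Sum>y\<in>Y. ln (p y + e) * u y) - a * ln a) +
        ((1 - a) * (\<Sum>y\<in>Y. ln (1 - p y + e) * v y) - (1 - a) * ln (1 - a))"
      by (simp add: sum.distrib sum_subtractf sums flip: sum_distrib_left)
    also have "\<dots> \<le> Phi_shift \<rho>0 \<rho>1 e a R"
      unfolding Phi_shift_def R(2)
    proof (intro add_mono diff_right_mono mult_left_mono)
      show "(\<Sum>y\<in>Y. ln (p y + e) * u y) \<le> trace_log \<rho>0 (R + e *\<^sub>R mat 1)"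
        using trace_log_povm_mixture[OF \<rho>(1) M p(1) e] by (simp add: R_def u_def)
      show "(\<Sum>y\<in>Y. ln (1 - p y + e) * v y) \<le> trace_log \<rho>1 ((\<Sum>y\<in>Y. (1 - p y) *\<^sub>R M y) + e *\<^sub>R mat 1)"
        using trace_log_povm_mixture[OF \<rho>(2) M, of "\<lambda>y. 1 - p y", OF _ e] p(2) by (simp add: v_def)
    qed (use a in auto)
    finally show ?thesis .
  qed
  thus ?thesis using R(1) by blast
qed

lemma povm_trivial: "povm {0} (\<lambda>_. mat 1 :: complex^'n^'n)"
  by (simp add: povm_def psd_one)

text \<open>\<open>Sup\<close> on the reals dominates its elements only for a set bounded above; the
  objective shifted by e = 1 supplies the bound.\<close>

lemma mutual_info_le_accessible:
  fixes \<rho>0 \<rho>1 :: "complex^'n^'n"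
  assumes \<rho>: "density_op \<rho>0" "density_op \<rho>1" and a: "0 < a" "a < 1" and M: "povm Y M"
  shows "mutual_info \<rho>0 \<rho>1 a Y M \<le> accessible_info \<rho>0 \<rho>1 a"
proof -
  have "bdd_above {mutual_info \<rho>0 \<rho>1 a Y M | Y M. povm Y M}"
  proof (rule bdd_aboveI, safe)
    fix Y and M :: "nat \<Rightarrow> complex^'n^'n" assume "povm Y M"
    then obtain R where "R \<in> effects" "mutual_info \<rho>0 \<rho>1 a Y M \<le> Phi_shift \<rho>0 \<rho>1 1 a R"
      using mutual_info_le_Phi_shift[OF \<rho> a] zero_less_one by blast
    thus "mutual_info \<rho>0 \<rho>1 a Y M \<le> ln (1 + 1) - a * ln a - (1 - a) * ln (1 - a)"
      using Phi_shift_le[OF \<rho> zero_less_one a] by (meson order_trans)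
  qed
  thus ?thesis unfolding accessible_info_def using a M by (auto intro!: cSup_upper)
qed

lemma Phi_inf_le_accessible:
  fixes \<rho>0 \<rho>1 R :: "complex^'n^'n"
  assumes \<rho>: "density_op \<rho>0" "density_op \<rho>1" and a: "0 < a" "a < 1" and R: "R \<in> effects"
  shows "Phi_inf \<rho>0 \<rho>1 a R \<le> ereal (accessible_info \<rho>0 \<rho>1 a)"
proof (cases "supp \<rho>0 \<subseteq> supp R \<and> supp \<rho>1 \<subseteq> supp (mat 1 - R)")
  case True
  note hR = psd_hermitian[OF effects_psd(1)[OF R]]
  have \<rho>psd: "psd \<rho>0" "psd \<rho>1" using \<rho> by (auto simp: density_op_def)
  have w0: "spec_weight \<rho>0 R 0 = 0" and "spec_weight \<rho>1 (mat 1 - R) 0 = 0"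
    using True \<rho>psd by (auto simp: supp_subset_iff)
  \<comment> \<open>The kernel of 1 - R is the eigenspace of \<open>R\<close> at 1.\<close>
  hence w1: "spec_weight \<rho>1 R 1 = 0"
    using eigenproj_affine[of "-1" R 1 1] by (simp add: spec_weight_def)
  \<comment> \<open>Outcomes are natural numbers, so the eigenvalues are encoded by an
    injection.\<close>
  obtain f :: "real \<Rightarrow> nat" where f: "inj_on f (eigenvals R)"
    using finite_imp_inj_to_nat_seg[OF finite_eigenvals[OF hR]] by blast
  define M where "M y = eigenproj R (the_inv_into (eigenvals R) f y)" for y
  have M: "M (f l) = eigenproj R l" if "l \<in> eigenvals R" for l
    using that f by (simp add: M_def the_inv_into_f_f)
  have povm: "povm (f ` eigenvals R) M"
    using finite_eigenvals[OF hR] sum_eigenproj[OF hR]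
    by (auto simp: povm_def sum.reindex[OF f] M eigenproj_psd)
  \<comment> \<open>Expanding both logarithms over the eigenprojections of \<open>R\<close> makes
    the comparison termwise in its eigenvalues.\<close>
  have log1: "trace_log \<rho>1 ((1 / (1 - a)) *\<^sub>R (mat 1 - R)) =
      (\<Sum>l\<in>eigenvals R. ln ((1 - l) / (1 - a)) * spec_weight \<rho>1 R l)"
    using trace_log_affine[OF hR, of "- (1 / (1 - a))" \<rho>1 "1 / (1 - a)"] a
    by (simp add: scaleR_diff_right diff_divide_distrib)
  have "Phi_formula \<rho>0 \<rho>1 a R =
      a * (\<Sum>l\<in>eigenvals R. ln (l / a) * spec_weight \<rho>0 R l) +
      (1 - a) * (\<Sum>l\<in>eigenvals R. ln ((1 - l) / (1 - a)) * spec_weight \<rho>1 R l)"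
    unfolding Phi_formula_def trace_log_def[symmetric] log1 using trace_log_scale[OF hR, of "1 / a" \<rho>0] a by simp
  also have "\<dots> = (\<Sum>l\<in>eigenvals R. a * (ln (l / a) * spec_weight \<rho>0 R l) +
      (1 - a) * (ln ((1 - l) / (1 - a)) * spec_weight \<rho>1 R l))"
    by (simp add: sum.distrib sum_distrib_left)
  also have "\<dots> \<le> (\<Sum>l\<in>eigenvals R. let u = spec_weight \<rho>0 R l; v = spec_weight \<rho>1 R l;
      m = a * u + (1 - a) * v in a * u * ln (u / m) + (1 - a) * v * ln (v / m))"
    unfolding Let_def
    by (intro sum_mono mutual_info_term_ge a spec_weight_nonneg \<rho>psd)
       (use w0 w1 eigenval_nonneg[OF effects_psd(1)[OF R]] eigenval_le_one[OF effects_psd(2)[OF R]] in auto)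
  also have "\<dots> = mutual_info \<rho>0 \<rho>1 a (f ` eigenvals R) M"
    by (simp add: mutual_info_def sum.reindex[OF f] M spec_weight_def)
  also have "\<dots> \<le> accessible_info \<rho>0 \<rho>1 a"
    by (rule mutual_info_le_accessible[OF \<rho> a povm])
  finally show ?thesis using True by (simp add: Phi_inf_eq[OF \<rho> a R])
next
  case False
  thus ?thesis by (simp only: Phi_inf_eq[OF \<rho> a R] if_False) simp
qed

section \<open>Compactness of the set of effects and attainment of the supremum\<close>

lemma effects_contractive:
  fixes R :: "complex^'n^'n"
  assumes R: "R \<in> effects"
  shows "norm (R *v v) \<le> norm v"
proof -
  note hR = psd_hermitian[OF effects_psd(1)[OF R]]
  have form: "inner v ((\<Sum>l\<in>eigenvals R. r l *\<^sub>R eigenproj R l) *v v) =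
      (\<Sum>l\<in>eigenvals R. r l * inner v (eigenproj R l *v v))" for r
    by (simp add: matrix_vector_sum matrix_vector_scaleR inner_sum_right)
  have Rv: "R *v v = (\<Sum>l\<in>eigenvals R. l *\<^sub>R (eigenproj R l *v v))"
    by (subst (1) spectral_decomp[OF hR]) (simp add: matrix_vector_sum matrix_vector_scaleR)
  have "inner (R *v v) (R *v v) = inner v (R *v (R *v v))" by (rule hermitianD[OF hR])
  also have "R *v (R *v v) = (\<Sum>l\<in>eigenvals R. l\<^sup>2 *\<^sub>R (eigenproj R l *v v))"
    by (subst Rv) (simp add: linear_sum[OF linear_matrix_vector] matrix_vector_scaleR_right
        eigenproj_eigen power2_eq_square)
  also have "inner v \<dots> = (\<Sum>l\<in>eigenvals R. l\<^sup>2 * inner v (eigenproj R l *v v))"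
    by (simp add: inner_sum_right)
  also have "\<dots> \<le> (\<Sum>l\<in>eigenvals R. 1 * inner v (eigenproj R l *v v))"
    using eigenval_nonneg[OF effects_psd(1)[OF R]] eigenval_le_one[OF effects_psd(2)[OF R]] eigenproj_psd[of R]
    by (intro sum_mono mult_right_mono) (auto simp: psd_iff power_le_one)
  also have "\<dots> = inner v v"
    by (simp add: sum_eigenproj_vec[OF hR] flip: inner_sum_right)
  finally show ?thesis by (simp add: norm_le)
qed

text \<open>Closedness is a matter of weak inequalities and equations; boundedness comes from
  contractivity, which bounds each matrix entry by 1.\<close>

lemma compact_effects: "compact (effects :: (complex^'n^'n) set)"
proof -
  have "closed {R :: complex^'n^'n. psd R}"
    unfolding psd_iff hermitian_iff_selfadjoint matrix_vector_mult_def
    by (intro closed_Collect_conj closed_Collect_all closed_Collect_eq closed_Collect_le continuous_intros)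
  moreover from this have "closed ((\<lambda>R. mat 1 - R) -` {R :: complex^'n^'n. psd R})"
    by (intro closed_vimage continuous_intros)
  ultimately have "closed ({R :: complex^'n^'n. psd R} \<inter> (\<lambda>R. mat 1 - R) -` {R. psd R})"
    by (rule closed_Int)
  moreover have "(effects :: (complex^'n^'n) set) = {R. psd R} \<inter> (\<lambda>R. mat 1 - R) -` {R. psd R}"
    by (auto simp: effects_def)
  moreover have "norm R \<le> real (CARD('n) * CARD('n))" if R: "R \<in> effects" for R :: "complex^'n^'n"
  proof -
    have entry: "norm (R $ j $ i) \<le> 1" for i j
    proof -
      have "norm (R $ j $ i) = norm ((R *v axis i 1) $ j)" by (simp add: column_entry)
      also have "\<dots> \<le> norm (R *v axis i 1)" by (rule Finite_Cartesian_Product.norm_nth_le)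
      also have "\<dots> \<le> 1" using effects_contractive[OF R, of "axis i 1"] by simp
      finally show ?thesis .
    qed
    have "norm R \<le> (\<Sum>j\<in>UNIV. norm (R $ j))" unfolding norm_vec_def by (rule L2_set_le_sum) simp
    also have "\<dots> \<le> (\<Sum>j\<in>(UNIV::'n set). \<Sum>i\<in>(UNIV::'n set). norm (R $ j $ i))"
      by (intro sum_mono) (simp add: norm_vec_def[of "R $ _"] L2_set_le_sum)
    also have "\<dots> \<le> (\<Sum>j\<in>(UNIV::'n set). \<Sum>i\<in>(UNIV::'n set). 1)" by (intro sum_mono entry)
    finally show ?thesis by simp
  qed
  hence "bounded (effects :: (complex^'n^'n) set)" by (rule boundedI)
  ultimately show ?thesis by (simp add: compact_eq_bounded_closed)
qed

text \<open>Compactness: the superlevel sets of the shifted objectives are nested.\<close>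

lemma accessible_le_Phi_inf:
  fixes \<rho>0 \<rho>1 :: "complex^'n^'n"
  assumes \<rho>: "density_op \<rho>0" "density_op \<rho>1" and a: "0 < a" "a < 1"
  shows "\<exists>R\<in>effects. ereal (accessible_info \<rho>0 \<rho>1 a) \<le> Phi_inf \<rho>0 \<rho>1 a R"
proof -
  define A where "A = accessible_info \<rho>0 \<rho>1 a"
  \<comment> \<open>The sequence 1 / (n+1) suffices, as the shifted objective is monotone in e, and
    it yields a decreasing chain of compact sets.\<close>
  define K where "K n = {R \<in> effects. A \<le> Phi_shift \<rho>0 \<rho>1 (1 / real (Suc n)) a R}" for n
  have cont: "continuous_on effects (Phi_shift \<rho>0 \<rho>1 e a)" if "0 < e" for e
    using continuous_on_compose2[OF Phi_shift_continuous[OF \<rho> that], of effects "\<lambda>R. (a, R)"] a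
    by (force intro: continuous_intros)
  have comp: "compact (K n)" for n
  proof -
    have "closed (K n)" unfolding K_def
      by (intro continuous_on_closed_Collect_le cont compact_imp_closed compact_effects continuous_on_const) simp
    moreover have "K n = effects \<inter> K n" by (auto simp: K_def)
    ultimately show ?thesis using compact_effects compact_Int_closed by metis
  qed
  have nonempty: "K n \<noteq> {}" for n
  proof -
    have e: "0 < 1 / real (Suc n)" by simp
    have "effects \<noteq> ({} :: (complex^'n^'n) set)"
      by (auto simp: effects_def psd_one psd_zero intro: exI[of _ 0])
    then obtain R where R: "R \<in> effects"
      "\<And>S. S \<in> effects \<Longrightarrow> Phi_shift \<rho>0 \<rho>1 (1 / real (Suc n)) a S \<le> Phi_shift \<rho>0 \<rho>1 (1 / real (Suc n)) a R"
      using continuous_attains_sup[OF compact_effects _ cont[OF e]] by blast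
    have "A \<le> Phi_shift \<rho>0 \<rho>1 (1 / real (Suc n)) a R"
    proof -
      \<comment> \<open>Each POVM provides its own effect; the maximiser \<open>R\<close> of the
        shifted objective dominates them all, hence also the supremum.\<close>
      have "Sup {mutual_info \<rho>0 \<rho>1 a Y M | Y M. povm Y M} \<le> Phi_shift \<rho>0 \<rho>1 (1 / real (Suc n)) a R"
      proof (rule cSup_least)
        show "{mutual_info \<rho>0 \<rho>1 a Y M | Y M. povm Y M} \<noteq> {}" using povm_trivial by blast
        fix x assume "x \<in> {mutual_info \<rho>0 \<rho>1 a Y M | Y M. povm Y M}"
        then obtain S where "S \<in> effects" "x \<le> Phi_shift \<rho>0 \<rho>1 (1 / real (Suc n)) a S"
          using mutual_info_le_Phi_shift[OF \<rho> a] e by blast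
        with R(2) show "x \<le> Phi_shift \<rho>0 \<rho>1 (1 / real (Suc n)) a R" by (meson order_trans)
      qed
      thus ?thesis using a by (simp add: A_def accessible_info_def)
    qed
    thus ?thesis using R(1) by (auto simp: K_def)
  qed
  have "K n \<subseteq> K m" if "m \<le> n" for m n
    using Phi_shift_mono[OF \<rho>, of "1 / real (Suc n)" "1 / real (Suc m)" a] that a
    by (force simp: K_def frac_le)
  hence "(\<Inter>n. K n) \<noteq> {}" by (intro compact_nest comp nonempty) auto
  then obtain R where R: "\<And>n. R \<in> K n" by blast
  hence RE: "R \<in> effects" by (simp add: K_def)
  have "ereal A \<le> Phi_inf \<rho>0 \<rho>1 a R"
    unfolding Phi_inf_def
  proof (rule INF_greatest)
    fix e :: real assume "e \<in> {0<..}"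
    then obtain n where n: "1 / real (Suc n) < e" using nat_approx_posE by auto
    have "A \<le> Phi_shift \<rho>0 \<rho>1 (1 / real (Suc n)) a R" using R[of n] by (simp add: K_def)
    also have "\<dots> \<le> Phi_shift \<rho>0 \<rho>1 e a R"
      using n a by (intro Phi_shift_mono[OF \<rho> _ _ _ _ RE]) auto
    finally show "ereal A \<le> ereal (Phi_shift \<rho>0 \<rho>1 e a R)" by simp
  qed
  thus ?thesis using RE by (auto simp: A_def)
qed

text \<open>At an endpoint only one letter survives. Choosing \<open>R\<close> so that its operator
  is the identity makes the shifted objective a trace of log (1 + e), which is nonnegative.\<close>

lemma accessible_le_Phi_inf_closed:
  fixes \<rho>0 \<rho>1 :: "complex^'n^'n"
  assumes \<rho>: "density_op \<rho>0" "density_op \<rho>1" and a: "a \<in> {0..1}"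
  shows "\<exists>R\<in>effects. ereal (accessible_info \<rho>0 \<rho>1 a) \<le> Phi_inf \<rho>0 \<rho>1 a R"
proof (cases "0 < a \<and> a < 1")
  case True
  thus ?thesis using accessible_le_Phi_inf[OF \<rho>] by blast
next
  case False
  have nonneg: "0 \<le> trace_log \<rho> (mat 1 + e *\<^sub>R mat 1)" if "density_op \<rho>" "0 < e" for \<rho> :: "complex^'n^'n" and e
  proof -
    \<comment> \<open>Written as a shift of the zero matrix, the operator has an explicit spectral
      expansion.\<close>
    have "trace_log \<rho> (mat 1 + e *\<^sub>R mat 1) = trace_log \<rho> (0 + (1 + e) *\<^sub>R mat 1)"
      by (simp add: scaleR_add_left)
    also have "\<dots> = (\<Sum>l\<in>eigenvals (0 :: complex^'n^'n). ln (l + (1 + e)) * spec_weight \<rho> 0 l)"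
      by (rule trace_log_shift[OF hermitian_zero])
    also have "\<dots> \<ge> 0"
    proof (intro sum_nonneg mult_nonneg_nonneg spec_weight_nonneg ln_ge_zero)
      show "psd \<rho>" using that(1) by (simp add: density_op_def)
      fix l assume "l \<in> eigenvals (0 :: complex^'n^'n)"
      with psd_zero have "0 \<le> l" by (rule eigenval_nonneg)
      thus "1 \<le> l + (1 + e)" using that(2) by simp
    qed
    finally show ?thesis .
  qed
  have E: "0 \<in> (effects :: (complex^'n^'n) set)" "mat 1 \<in> (effects :: (complex^'n^'n) set)"
    by (simp_all add: effects_def psd_zero psd_one)
  from False a consider "a = 0" | "a = 1" by fastforce
  thus ?thesis
  proof cases
    case 1
    have "0 \<le> Phi_inf \<rho>0 \<rho>1 a 0"
      unfolding Phi_inf_def by (rule INF_greatest) (use 1 nonneg[OF \<rho>(2)] in \<open>simp add: Phi_shift_def\<close>)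
    thus ?thesis using E 1 by (intro bexI[of _ 0]) (simp_all add: accessible_info_def flip: zero_ereal_def)
  next
    case 2
    have "0 \<le> Phi_inf \<rho>0 \<rho>1 a (mat 1)"
      unfolding Phi_inf_def by (rule INF_greatest) (use 2 nonneg[OF \<rho>(1)] in \<open>simp add: Phi_shift_def\<close>)
    thus ?thesis using E 2 by (intro bexI[of _ "mat 1"]) (simp_all add: accessible_info_def flip: zero_ereal_def)
  qed
qed

text \<open>Good effects at a and b are mixed; joint concavity bounds the value of the mixture from
  below, and the accessible information at the intermediate point bounds it from above.\<close>

lemma concave_accessible_info:
  fixes \<rho>0 \<rho>1 :: "complex^'n^'n"
  assumes \<rho>: "density_op \<rho>0" "density_op \<rho>1"
  shows "concave_on {0..1} (accessible_info \<rho>0 \<rho>1)"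
proof (rule concave_on_linorderI)
  fix t a b :: real
  assume t: "0 < t" "t < 1" and ab: "a \<in> {0..1}" "b \<in> {0..1}" "a < b"
  let ?A = "accessible_info \<rho>0 \<rho>1"
  let ?c = "(1 - t) * a + t * b"
  obtain R S where R: "R \<in> effects" "ereal (?A a) \<le> Phi_inf \<rho>0 \<rho>1 a R"
    and S: "S \<in> effects" "ereal (?A b) \<le> Phi_inf \<rho>0 \<rho>1 b S"
    using accessible_le_Phi_inf_closed[OF \<rho>] ab by meson
  have RS: "(1 - t) *\<^sub>R R + t *\<^sub>R S \<in> effects"
    using convexD[OF convex_effects R(1) S(1), of "1 - t" t] t by simp
  \<comment> \<open>The upper bound is available only strictly inside the interval;
    \<open>?c\<close> lies there because a < b, even if a or b is an endpoint.\<close>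
  have "?c = a + t * (b - a)" "?c = b - (1 - t) * (b - a)" by (simp_all add: algebra_simps)
  moreover have "0 < t * (b - a)" "0 < (1 - t) * (b - a)" using t ab by auto
  ultimately have c: "0 < ?c" "?c < 1" using ab by auto
  have "ereal ((1 - t) * ?A a + t * ?A b) = ereal (1 - t) * ereal (?A a) + ereal t * ereal (?A b)" by simp
  also have "\<dots> \<le> ereal (1 - t) * Phi_inf \<rho>0 \<rho>1 a R + ereal t * Phi_inf \<rho>0 \<rho>1 b S"
    using t R S by (intro add_mono ereal_mult_left_mono) auto
  also have "\<dots> \<le> Phi_inf \<rho>0 \<rho>1 ?c ((1 - t) *\<^sub>R R + t *\<^sub>R S)"
    by (rule Phi_inf_concave[OF \<rho> ab(1,2) R(1) S(1) t])
  also have "\<dots> \<le> ereal (?A ?c)" by (rule Phi_inf_le_accessible[OF \<rho> c RS])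
  finally show "(1 - t) * ?A a + t * ?A b \<le> ?A ((1 - t) *\<^sub>R a + t *\<^sub>R b)" by simp
qed simp

theorem theorem11p1:
  fixes \<rho>0 \<rho>1 :: "complex^'n^'n"
  assumes "density_op \<rho>0" and "density_op \<rho>1"
  shows "(\<forall>a. 0 < a \<and> a < 1 \<longrightarrow>
            (\<exists>R\<in>effects. Phi \<rho>0 \<rho>1 a R = ereal (accessible_info \<rho>0 \<rho>1 a)) \<and>
            (\<forall>R\<in>effects. Phi \<rho>0 \<rho>1 a R \<le> ereal (accessible_info \<rho>0 \<rho>1 a))) \<and>
         (\<forall>a. \<forall>R\<in>effects. 0 < a \<and> a < 1 \<longrightarrow>
            Phi \<rho>0 \<rho>1 a R =
              (if supp \<rho>0 \<subseteq> supp R \<and> supp \<rho>1 \<subseteq> supp (mat 1 - R)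
               then ereal (Phi_formula \<rho>0 \<rho>1 a R) else - \<infinity>)) \<and>
         ereal_concave_on ({0..1} \<times> effects) (\<lambda>(a, R). Phi \<rho>0 \<rho>1 a R) \<and>
         concave_on {0..1} (accessible_info \<rho>0 \<rho>1)"
proof (intro conjI allI ballI impI)
  note \<rho> = assms
  fix a :: real assume a: "0 < a \<and> a < 1"
  have Phi: "Phi \<rho>0 \<rho>1 a R = Phi_inf \<rho>0 \<rho>1 a R" if "R \<in> effects" for R
    using a that by (intro Phi_eq_Phi_inf[OF \<rho>]) auto
  show le: "Phi \<rho>0 \<rho>1 a R \<le> ereal (accessible_info \<rho>0 \<rho>1 a)" if "R \<in> effects" for R
    using a that by (simp add: Phi Phi_inf_le_accessible[OF \<rho>])
  show "\<exists>R\<in>effects. Phi \<rho>0 \<rho>1 a R = ereal (accessible_info \<rho>0 \<rho>1 a)"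
    using accessible_le_Phi_inf[OF \<rho>, of a] a le Phi by (metis order_antisym)
  fix R :: "complex^'n^'n" assume R: "R \<in> effects"
  show "Phi \<rho>0 \<rho>1 a R = (if supp \<rho>0 \<subseteq> supp R \<and> supp \<rho>1 \<subseteq> supp (mat 1 - R)
               then ereal (Phi_formula \<rho>0 \<rho>1 a R) else - \<infinity>)"
    using a by (simp only: Phi[OF R] Phi_inf_eq[OF \<rho> _ _ R])
next
  note \<rho> = assms
  show "concave_on {0..1} (accessible_info \<rho>0 \<rho>1)" by (rule concave_accessible_info[OF \<rho>])
  have conv: "convex ({0..1::real} \<times> (effects :: (complex^'n^'n) set))"
    by (intro convex_Times convex_effects) simp
  show "ereal_concave_on ({0..1} \<times> effects) (\<lambda>(a, R). Phi \<rho>0 \<rho>1 a R)"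
    unfolding ereal_concave_on_def
  proof (intro conjI conv ballI allI impI)
    fix x y :: "real \<times> (complex^'n^'n)" and t :: real
    assume x: "x \<in> {0..1} \<times> effects" and y: "y \<in> {0..1} \<times> effects" and t: "0 < t \<and> t < 1"
    obtain a R b S where xy: "x = (a, R)" "y = (b, S)" by (cases x, cases y)
    have "(1 - t) *\<^sub>R x + t *\<^sub>R y \<in> {0..1} \<times> effects"
      using convexD[OF conv x y, of "1 - t" t] t by simp
    thus "ereal (1 - t) * (case x of (a, R) \<Rightarrow> Phi \<rho>0 \<rho>1 a R) + ereal t * (case y of (a, R) \<Rightarrow> Phi \<rho>0 \<rho>1 a R)
        \<le> (case (1 - t) *\<^sub>R x + t *\<^sub>R y of (a, R) \<Rightarrow> Phi \<rho>0 \<rho>1 a R)"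
      using x y t Phi_inf_concave[OF \<rho>, of a b R S t] by (simp add: xy Phi_eq_Phi_inf[OF \<rho>])
  qed
qed

end
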